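(* For the finite horizon Bayesian multi-armed bandit problem with instantaneous feedback (with budgets and arbitrary priors), one can compute in time $\mathrm{poly}(T,\sum_i|\mathcal{S}_i|)$ a policy whose expected reward is at least half of the expected reward of the optimal policy (a $2$-approximation).
   Context: Problem: there are $n$ independent arms. Arm $i$ has an unknown reward distribution $D_i$ drawn from a known prior $\mathcal{D}_i$; each play of arm $i$ yields a reward drawn i.i.d. from $D_i$, and its outcome is observed immediately. Arm $i$ has a budget $B_i$: the total reward that can be accrued from arm $i$ is at most $B_i$ (further plays accrue no reward). The input specifies for each arm the posterior space $\mathcal{S}_i$: a DAG rooted at $\mathcal{D}_i$, each state $u$ corresponding to a set of observations and the Bayesian posterior after them, with transition probabilities $p_{uv}$ given by the probability of the next observation under the posterior at $u$. There is a horizon of $T$ steps, one play per step. A policy chooses, based on the current state of all arms (posteriors and remaining budgets and time), which arm to play next; its value is its expected total reward. The goal is to maximize expected total reward. *)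

theory Defs
  imports "HOL-Probability.Probability" "HOL-Computational_Algebra.Polynomial"
begin

section \<open>Bayesian updating\<close>

text \<open>A prior is a probability measure on the space of (Borel) probability distributions of the
  reward of one play. Observations are recorded as a multiset of observed rewards.\<close>

definition likelihood :: "real multiset \<Rightarrow> real measure \<Rightarrow> real" where
  "likelihood obs D = (\<Prod>x\<in>#obs. measure D {x})"

definition posterior :: "real measure measure \<Rightarrow> real multiset \<Rightarrow> real measure measure" where
  "posterior M obs = density M
     (\<lambda>D. ennreal (likelihood obs D) / (\<integral>\<^sup>+D'. ennreal (likelihood obs D') \<partial>M))"

definition predictive :: "real measure measure \<Rightarrow> real multiset \<Rightarrow> real \<Rightarrow> real" where
  "predictive M obs x = (\<integral>D. measure D {x} \<partial>posterior M obs)"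

text \<open>\<open>posterior_space M T N P X\<close>: the states \<open>0, \<dots>, N - 1\<close> with root \<open>0\<close>, transition
  probabilities \<open>P\<close> and edge labels \<open>X\<close> (\<open>X u v\<close> is the reward observed when moving from \<open>u\<close>
  to \<open>v\<close>) form the posterior space of the prior \<open>M\<close>. There is an edge from \<open>u\<close> to \<open>v\<close> iff
  \<open>P u v > 0\<close>. Since each edge adds one observation, the graph is acyclic. The last conjunct
  says that every possible outcome of a play within the horizon \<open>T\<close> is represented. Distinct
  states may carry the same observations, so that trees of histories are allowed as well.\<close>

definition posterior_space ::
  "real measure measure \<Rightarrow> nat \<Rightarrow> nat \<Rightarrow> (nat \<Rightarrow> nat \<Rightarrow> real) \<Rightarrow> (nat \<Rightarrow> nat \<Rightarrow> real) \<Rightarrow> bool" where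
  "posterior_space M T N P X \<longleftrightarrow> 0 < N \<and>
     (\<forall>u<N. (0, u) \<in> {(a, b). a < N \<and> b < N \<and> 0 < P a b}\<^sup>*) \<and>
     (\<forall>u<N. \<forall>v<N. 0 \<le> P u v) \<and>
     (\<forall>u<N. inj_on (X u) {v. v < N \<and> 0 < P u v}) \<and>
     (\<exists>obs :: nat \<Rightarrow> real multiset.
        obs 0 = {#} \<and>
        (\<forall>u<N. \<forall>v<N. 0 < P u v \<longrightarrow>
           obs v = add_mset (X u v) (obs u) \<and> P u v = predictive M (obs u) (X u v)) \<and>
        (\<forall>u<N. size (obs u) < T \<longrightarrow> (\<Sum>v<N. P u v) = 1))"


section \<open>The budgeted finite horizon bandit problem\<close>

record bandit =
  arms :: nat
  horizon :: nat
  num_states :: "nat \<Rightarrow> nat"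
  trans_prob :: "nat \<Rightarrow> nat \<Rightarrow> nat \<Rightarrow> real"
  outcome :: "nat \<Rightarrow> nat \<Rightarrow> nat \<Rightarrow> real"
  budget :: "nat \<Rightarrow> real"

definition bayesian_bandit :: "bandit \<Rightarrow> (nat \<Rightarrow> real measure measure) \<Rightarrow> bool" where
  "bayesian_bandit I prior \<longleftrightarrow> 0 < arms I \<and>
     (\<forall>i<arms I.
        prior i \<in> space (prob_algebra (prob_algebra borel)) \<and>
        (AE D in prior i. AE x in D. 0 \<le> x) \<and>
        0 \<le> budget I i \<and>
        posterior_space (prior i) (horizon I) (num_states I i) (trans_prob I i) (outcome I i))"

text \<open>A policy maps the remaining time, the posterior state of every arm and the remaining budget
  of every arm to the arm that is played next.\<close>

type_synonym policy = "nat \<Rightarrow> (nat \<Rightarrow> nat) \<Rightarrow> (nat \<Rightarrow> real) \<Rightarrow> nat"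

definition policies :: "bandit \<Rightarrow> policy set" where
  "policies I = {\<pi>. \<forall>t s b. \<pi> t s b < arms I}"

text \<open>Expected reward of the last \<open>t\<close> steps when the true reward distributions are \<open>D\<close>, the
  posterior states are \<open>s\<close> and the remaining budgets are \<open>b\<close>: a play of arm \<open>i\<close> yields
  the observation \<open>x\<close> with probability \<open>measure (D i) {x}\<close>, whatever the past, and
  accrues \<open>min (b i) x\<close>.\<close>

primrec reward_given ::
  "bandit \<Rightarrow> policy \<Rightarrow> (nat \<Rightarrow> real measure) \<Rightarrow> nat \<Rightarrow> (nat \<Rightarrow> nat) \<Rightarrow> (nat \<Rightarrow> real) \<Rightarrow> real" where
  "reward_given I \<pi> D 0 s b = 0"
| "reward_given I \<pi> D (Suc t) s b =
     (let i = \<pi> (Suc t) s b in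
       \<Sum>v | v < num_states I i \<and> 0 < trans_prob I i (s i) v.
         let x = outcome I i (s i) v; g = min (b i) x in
           measure (D i) {x} * (g + reward_given I \<pi> D t (s(i := v)) (b(i := b i - g))))"

definition expected_reward :: "bandit \<Rightarrow> (nat \<Rightarrow> real measure measure) \<Rightarrow> policy \<Rightarrow> real" where
  "expected_reward I prior \<pi> =
     (\<integral>D. reward_given I \<pi> D (horizon I) (\<lambda>_. 0) (budget I) \<partial>(PiM {..<arms I} prior))"

definition optimal_reward :: "bandit \<Rightarrow> (nat \<Rightarrow> real measure measure) \<Rightarrow> real" where
  "optimal_reward I prior = (SUP \<pi>\<in>policies I. expected_reward I prior \<pi>)"


section \<open>Machine model\<close>

text \<open>A unit-cost random access machine over the reals. Memory consists of arrays of naturals and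
  arrays of reals, addressed by a name and a list of indices (scalars use the empty list). Reals
  admit the four field operations, integer constants and comparison, but no rounding. Naturals admit
  only addition, truncated subtraction and comparison: with unit-cost multiplication of naturals,
  polynomially many steps could produce numbers of exponential length. Every assignment and every
  test costs one step; expressions have a size fixed by the program, so charging for their
  size would change running times by a constant factor only.\<close>

datatype nexp = NConst nat | NGet string "nexp list" | NAdd nexp nexp | NSub nexp nexp

datatype rexp = RConst int | RGet string "nexp list"
  | RAdd rexp rexp | RSub rexp rexp | RMul rexp rexp | RDiv rexp rexp

datatype bexp = NLess nexp nexp | RLess rexp rexp | BNot bexp | BAnd bexp bexp

datatype com = Skip
  | NSet string "nexp list" nexp
  | RSet string "nexp list" rexp
  | Seq com com
  | Cond bexp com com
  | While bexp com

record mem =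
  nats :: "string \<Rightarrow> nat list \<Rightarrow> nat"
  reals :: "string \<Rightarrow> nat list \<Rightarrow> real"

primrec neval :: "mem \<Rightarrow> nexp \<Rightarrow> nat" where
  "neval m (NConst k) = k"
| "neval m (NGet a es) = nats m a (map (neval m) es)"
| "neval m (NAdd e f) = neval m e + neval m f"
| "neval m (NSub e f) = neval m e - neval m f"

primrec reval :: "mem \<Rightarrow> rexp \<Rightarrow> real" where
  "reval m (RConst k) = of_int k"
| "reval m (RGet a es) = reals m a (map (neval m) es)"
| "reval m (RAdd e f) = reval m e + reval m f"
| "reval m (RSub e f) = reval m e - reval m f"
| "reval m (RMul e f) = reval m e * reval m f"
| "reval m (RDiv e f) = reval m e / reval m f"

primrec beval :: "mem \<Rightarrow> bexp \<Rightarrow> bool" where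
  "beval m (NLess e f) = (neval m e < neval m f)"
| "beval m (RLess e f) = (reval m e < reval m f)"
| "beval m (BNot b) = (\<not> beval m b)"
| "beval m (BAnd b c) = (beval m b \<and> beval m c)"

definition set_nat :: "string \<Rightarrow> nat list \<Rightarrow> nat \<Rightarrow> mem \<Rightarrow> mem" where
  "set_nat a is k m = m\<lparr>nats := (nats m)(a := (nats m a)(is := k))\<rparr>"

definition set_real :: "string \<Rightarrow> nat list \<Rightarrow> real \<Rightarrow> mem \<Rightarrow> mem" where
  "set_real a is r m = m\<lparr>reals := (reals m)(a := (reals m a)(is := r))\<rparr>"

text \<open>\<open>exec c m k m'\<close>: started in memory \<open>m\<close>, program \<open>c\<close> halts after \<open>k\<close> steps in memory \<open>m'\<close>.\<close>

inductive exec :: "com \<Rightarrow> mem \<Rightarrow> nat \<Rightarrow> mem \<Rightarrow> bool" where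
  Skip: "exec Skip m 1 m"
| NSet: "exec (NSet a es e) m 1 (set_nat a (map (neval m) es) (neval m e) m)"
| RSet: "exec (RSet a es e) m 1 (set_real a (map (neval m) es) (reval m e) m)"
| Seq: "exec c m k m' \<Longrightarrow> exec d m' l m'' \<Longrightarrow> exec (Seq c d) m (k + l) m''"
| CondTrue: "beval m b \<Longrightarrow> exec c m k m' \<Longrightarrow> exec (Cond b c d) m (k + 1) m'"
| CondFalse: "\<not> beval m b \<Longrightarrow> exec d m k m' \<Longrightarrow> exec (Cond b c d) m (k + 1) m'"
| WhileFalse: "\<not> beval m b \<Longrightarrow> exec (While b c) m 1 m"
| WhileTrue: "beval m b \<Longrightarrow> exec c m k m' \<Longrightarrow> exec (While b c) m' l m'' \<Longrightarrow>
    exec (While b c) m (k + l + 1) m''"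


section \<open>Computing a policy\<close>

text \<open>The machine is given the posterior spaces as weighted graphs; everything else is zero.\<close>

definition input_mem :: "bandit \<Rightarrow> mem" where
  "input_mem I = \<lparr>
     nats = (\<lambda>a is.
       if a = ''arms'' \<and> is = [] then arms I
       else if a = ''horizon'' \<and> is = [] then horizon I
       else case is of
         [i] \<Rightarrow> if a = ''states'' \<and> i < arms I then num_states I i else 0
       | _ \<Rightarrow> 0),
     reals = (\<lambda>a is. case is of
         [i] \<Rightarrow> if a = ''budget'' \<and> i < arms I then budget I i else 0
       | [i, u, v] \<Rightarrow>
           if i < arms I \<and> u < num_states I i \<and> v < num_states I i \<and> 0 < trans_prob I i u v
           then if a = ''prob'' then trans_prob I i u v
                else if a = ''outcome'' then outcome I i u v
                else 0
           else 0
       | _ \<Rightarrow> 0)\<rparr>"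

definition query_mem :: "bandit \<Rightarrow> nat \<Rightarrow> (nat \<Rightarrow> nat) \<Rightarrow> (nat \<Rightarrow> real) \<Rightarrow> mem \<Rightarrow> mem" where
  "query_mem I t s b m = \<lparr>
     nats = (nats m)
       (''time'' := (\<lambda>is. if is = [] then t else 0),
        ''current'' := (\<lambda>is. case is of [i] \<Rightarrow> if i < arms I then s i else 0 | _ \<Rightarrow> 0)),
     reals = (reals m)
       (''remaining'' := (\<lambda>is. case is of [i] \<Rightarrow> if i < arms I then b i else 0 | _ \<Rightarrow> 0))\<rparr>"

text \<open>A policy has exponentially many arguments, so it is computed in the form of a data structure:
  \<open>plan\<close> transforms the input into a memory content, from which \<open>act\<close> determines the arm
  to play for any given remaining time, states and remaining budgets. Both
  phases have to halt within \<open>K\<close> steps.\<close>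

definition computes_policy_within :: "com \<Rightarrow> com \<Rightarrow> nat \<Rightarrow> bandit \<Rightarrow> policy \<Rightarrow> bool" where
  "computes_policy_within plan act K I \<pi> \<longleftrightarrow>
     (\<exists>k m. k \<le> K \<and> exec plan (input_mem I) k m \<and>
        (\<forall>t s b. 0 < t \<and> t \<le> horizon I \<and>
             (\<forall>i<arms I. s i < num_states I i \<and> 0 \<le> b i \<and> b i \<le> budget I i) \<longrightarrow>
           (\<exists>k' m'. k' \<le> K \<and> exec act (query_mem I t s b m) k' m' \<and>
              nats m' ''arm'' [] = \<pi> t s b)))"

definition input_size :: "bandit \<Rightarrow> nat" where
  "input_size I = horizon I + (\<Sum>i<arms I. num_states I i)"

end

theory Submission
  imports Defs
begin

text \<open>Fix an order of the arms and consider only policies that play them one after the other, never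
  returning to an abandoned arm. The best such policy is found by a dynamic program over the current
  arm, its state and the remaining time. The algorithm does this for some order and for its reverse
  and takes the better result.

  To compare with an arbitrary policy, let \<open>R\<^sub>i\<close> be its expected reward and \<open>M\<^sub>i\<close> its expected number of
  plays on arm \<open>i\<close>, so that \<open>\<Sum>M\<^sub>i \<le> T\<close>. Its behaviour on a single arm can be imitated without looking
  at the other arms. Under Bayesian updating the expected gain of the next play is a supermartingale
  (a martingale but for the shrinking budget), so that imitating it for the first \<open>t\<close> steps only
  earns at least \<open>(t / T) R\<^sub>i\<close>. Imitating the arms one after the other therefore earns at least
  \<open>\<Sum>\<^sub>i R\<^sub>i (1 - \<Sum>M\<^sub>j / T)\<close>, where \<open>j\<close> ranges over the arms played before \<open>i\<close>. Adding up the bounds for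
  both orders, every arm \<open>j \<noteq> i\<close> comes before \<open>i\<close> exactly once, so the sum is at least
  \<open>\<Sum>\<^sub>i R\<^sub>i (2 - 1)\<close>, and one of the two orders earns at least half of \<open>\<Sum>R\<^sub>i\<close>.\<close>

section \<open>Finite sums\<close>

text \<open>The imitation of a policy on one arm is never built as a policy. What is kept of it is
  its occupation vector \<open>z i u\<close>, the probability of playing arm \<open>i\<close> in
  state \<open>u\<close>, and the flow inequality that \<open>z\<close> satisfies. As in weak
  duality for linear programs, the optimal value \<open>arm_value\<close> dominates what any such
  \<open>z\<close> earns, so no randomisation enters the algorithm. The time lost to earlier arms is
  handled by lower bounds of the form \<alpha> t - \<beta> on the value of the later ones: a play
  then costs exactly \<alpha>, no matter when it occurs, and the form is preserved when another arm
  is put in front. Budgets do not enlarge the state space, since the remaining budget of an arm is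
  determined by its observations, hence by its state. The obstacle is the horizon: from depth
  \<open>T\<close> on a posterior space may omit outcomes, and the machine is only shown to know
  remaining budgets up to depth \<open>T\<close>. The laws on probabilities, budgets and gains are
  therefore restricted to states above that depth, and policies are followed along an invariant that
  keeps all plays there.\<close>

lemma antimono_prefix_average:
  fixes a :: "nat \<Rightarrow> real"
  assumes "\<And>k. Suc k < m \<Longrightarrow> a (Suc k) \<le> a k" and "t \<le> m"
  shows "real t * (\<Sum>k<m. a k) \<le> real m * (\<Sum>k<t. a k)"
proof (cases "t = m")
  case False
  have anti: "a l \<le> a k" if "k \<le> l" "l < m" for k l
    using that by (induction rule: dec_induct) (use assms(1) in force)+
  have t: "t < m" using False assms by simp
  \<comment> \<open>The pivot \<open>a t\<close> separates the two parts: prefix terms are at least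
    \<open>a t\<close>, the remaining terms at most \<open>a t\<close>.\<close>
  have lo: "real t * a t \<le> (\<Sum>k<t. a k)"
    using sum_bounded_below[of "{..<t}" "a t" a] anti t by simp
  have "(\<Sum>k=t..<m. a k) \<le> real (m - t) * a t"
    using sum_bounded_above[of "{t..<m}" a "a t"] anti by simp
  then have hi: "(\<Sum>k=t..<m. a k) \<le> (real m - real t) * a t" using t by simp
  have split: "(\<Sum>k<m. a k) = (\<Sum>k<t. a k) + (\<Sum>k=t..<m. a k)"
    using t by (metis atLeast0LessThan less_imp_le sum.atLeastLessThan_concat zero_le)
  have "real t * (\<Sum>k=t..<m. a k) \<le> (real m - real t) * (real t * a t)"
    using mult_left_mono[OF hi, of "real t"] by (simp add: mult_ac)
  also have "\<dots> \<le> (real m - real t) * (\<Sum>k<t. a k)"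
    using lo t by (intro mult_left_mono) auto
  finally show ?thesis unfolding split by (simp add: algebra_simps)
qed simp

text \<open>Reflecting both indices turns the second sum into the pairs with \<open>j > k\<close>,
  so the three sums cover the full square of index pairs. This is the count behind pairing an order
  with its reverse.\<close>

lemma sum_both_triangles:
  fixes a b :: "nat \<Rightarrow> real"
  shows "(\<Sum>k<m. (\<Sum>j<k. a j) * b k) + (\<Sum>k<m. (\<Sum>j<k. a (m - Suc j)) * b (m - Suc k)) +
    (\<Sum>k<m. a k * b k) = (\<Sum>k<m. a k) * (\<Sum>k<m. b k)"
proof -
  have refl_sum: "(\<Sum>j<k. a (m - Suc j)) = (\<Sum>j\<in>{m-k..<m}. a j)" if "k \<le> m" for k
    by (rule sum.reindex_bij_witness[of _ "\<lambda>j. m - Suc j" "\<lambda>j. m - Suc j"]) (use that in auto)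
  have "(\<Sum>k<m. (\<Sum>j<k. a (m - Suc j)) * b (m - Suc k)) = (\<Sum>k<m. (\<Sum>j\<in>{Suc k..<m}. a j) * b k)"
    by (rule sum.reindex_bij_witness[of _ "\<lambda>j. m - Suc j" "\<lambda>j. m - Suc j"])
       (auto simp: refl_sum Suc_diff_Suc)
  moreover have "(\<Sum>j<k. a j) + (\<Sum>j\<in>{Suc k..<m}. a j) + a k = (\<Sum>j<m. a j)" if "k < m" for k
  proof -
    have "{..<m} = insert k ({..<k} \<union> {Suc k..<m})" using that by auto
    then show ?thesis by (simp add: sum.union_disjoint disjoint_iff)
  qed
  then have "(\<Sum>k<m. (\<Sum>j<m. a j) * b k) =
      (\<Sum>k<m. (\<Sum>j<k. a j) * b k + (\<Sum>j\<in>{Suc k..<m}. a j) * b k + a k * b k)"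
    by (intro sum.cong refl) (simp flip: distrib_right)
  ultimately show ?thesis by (simp add: sum.distrib flip: sum_distrib_left)
qed


section \<open>Playing the arms one after the other in a fixed order\<close>

text \<open>The remaining budget is read off the state through \<open>bd\<close>. This table is left
  arbitrary because the algorithm later works with the array that it has computed itself.\<close>

definition mean_gain :: "bandit \<Rightarrow> (nat \<Rightarrow> nat \<Rightarrow> real) \<Rightarrow> nat \<Rightarrow> nat \<Rightarrow> real" where
  "mean_gain I bd i u = (\<Sum>v<num_states I i. trans_prob I i u v * min (bd i u) (outcome I i u v))"

text \<open>Optimal value of arm \<open>i\<close> in state \<open>u\<close> with \<open>t\<close> steps left if \<open>H t'\<close> can be cashed in for
  abandoning the arm for good with \<open>t'\<close> steps left.\<close>

primrec arm_value ::
  "bandit \<Rightarrow> (nat \<Rightarrow> nat \<Rightarrow> real) \<Rightarrow> nat \<Rightarrow> (nat \<Rightarrow> real) \<Rightarrow> nat \<Rightarrow> nat \<Rightarrow> real" where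
  "arm_value I bd i H 0 u = H 0"
| "arm_value I bd i H (Suc t) u = max (H (Suc t)) (\<Sum>v<num_states I i.
     trans_prob I i u v * (min (bd i u) (outcome I i u v) + arm_value I bd i H t v))"

text \<open>The arms are played in the order \<open>ord (q - 1), \<dots>, ord 0\<close>.\<close>

primrec stage_value ::
  "bandit \<Rightarrow> (nat \<Rightarrow> nat \<Rightarrow> real) \<Rightarrow> (nat \<Rightarrow> nat) \<Rightarrow> nat \<Rightarrow> nat \<Rightarrow> real" where
  "stage_value I bd ord 0 t = 0"
| "stage_value I bd ord (Suc q) t = arm_value I bd (ord q) (stage_value I bd ord q) t 0"

text \<open>The arm in progress is recognised without memory: it is the last one in playing order that
  has left its root. If no arm is worth playing, \<open>ord 0\<close> serves as a default.\<close>

primrec pick_arm :: "bandit \<Rightarrow> (nat \<Rightarrow> nat \<Rightarrow> real) \<Rightarrow> (nat \<Rightarrow> nat) \<Rightarrow> nat \<Rightarrow> (nat \<Rightarrow> nat) \<Rightarrow> nat \<Rightarrow> nat" where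
  "pick_arm I bd ord t s 0 = ord 0"
| "pick_arm I bd ord t s (Suc k) =
     (if (\<forall>j<k. s (ord j) = 0) \<and>
         stage_value I bd ord k t < arm_value I bd (ord k) (stage_value I bd ord k) t (s (ord k))
      then ord k else pick_arm I bd ord t s k)"

definition sequential_policy :: "bandit \<Rightarrow> (nat \<Rightarrow> nat \<Rightarrow> real) \<Rightarrow> (nat \<Rightarrow> nat) \<Rightarrow> policy" where
  "sequential_policy I bd ord t s b = pick_arm I bd ord t s (arms I)"

text \<open>Value of continuing the fixed-order game in mid-play: the arms that precede the one in
  progress are lost, those after it are untouched. It is the potential for the induction on time
  that evaluates \<open>sequential_policy\<close>.\<close>

primrec progress_value ::
  "bandit \<Rightarrow> (nat \<Rightarrow> nat \<Rightarrow> real) \<Rightarrow> (nat \<Rightarrow> nat) \<Rightarrow> nat \<Rightarrow> (nat \<Rightarrow> nat) \<Rightarrow> nat \<Rightarrow> real" where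
  "progress_value I bd ord t s 0 = 0"
| "progress_value I bd ord t s (Suc k) =
     (if \<forall>j<k. s (ord j) = 0
      then arm_value I bd (ord k) (stage_value I bd ord k) t (s (ord k))
      else progress_value I bd ord t s k)"

section \<open>Bellman equation of the fixed-order game\<close>

lemma stage_value_time_0: "stage_value I bd ord q 0 = 0"
  by (induction q) auto

lemma arm_value_ge: "H t \<le> arm_value I bd i H t u"
  by (cases t) auto

lemma arm_value_Suc_ge:
  "mean_gain I bd i u + (\<Sum>v<num_states I i. trans_prob I i u v * arm_value I bd i H t v)
     \<le> arm_value I bd i H (Suc t) u"
  by (simp add: mean_gain_def distrib_left sum.distrib)

lemma progress_value_untouched:
  "\<forall>j<k. s (ord j) = 0 \<Longrightarrow> progress_value I bd ord t s k = stage_value I bd ord k t"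
  by (cases k) auto

lemma progress_value_time_0: "progress_value I bd ord 0 s k = 0"
  by (induction k) (auto simp: stage_value_time_0)

lemma progress_value_touched:
  assumes "q < k" "s (ord q) \<noteq> 0" "\<forall>j<q. s (ord j) = 0"
  shows "progress_value I bd ord t s k =
    arm_value I bd (ord q) (stage_value I bd ord q) t (s (ord q))"
  using assms(1)
proof (induction k)
  case (Suc k)
  show ?case
  proof (cases "q = k")
    case True
    then show ?thesis using assms by simp
  next
    case False
    then have "q < k" using Suc.prems by simp
    then show ?thesis using Suc.IH assms by auto
  qed
qed simp

text \<open>Bellman's equation for the choice made by \<open>pick_arm\<close>. The first alternative
  covers the default \<open>ord 0\<close>, which need not attain the value; there it will be enough
  that gains are nonnegative.\<close>

lemma pick_arm_attains_progress_value:
  assumes "0 < t"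
  shows "progress_value I bd ord t s k \<le> 0 \<or>
    (\<exists>q<k. pick_arm I bd ord t s k = ord q \<and> (\<forall>j<q. s (ord j) = 0) \<and>
      progress_value I bd ord t s k = mean_gain I bd (ord q) (s (ord q)) +
        (\<Sum>v<num_states I (ord q). trans_prob I (ord q) (s (ord q)) v *
           arm_value I bd (ord q) (stage_value I bd ord q) (t - 1) v))"
    (is "?A k \<or> ?B k")
proof (induction k)
  case (Suc k)
  obtain t' where t: "t = Suc t'" using assms by (cases t) auto
  let ?a = "arm_value I bd (ord k) (stage_value I bd ord k) t (s (ord k))"
  \<comment> \<open>Playing \<open>ord k\<close> strictly beats leaving it; or leaving it is optimal
    and the value is that of the arms below \<open>k\<close>; or one of those has been touched, so
    \<open>ord k\<close> has been passed already.\<close>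
  consider "\<forall>j<k. s (ord j) = 0" "stage_value I bd ord k t < ?a"
    | "\<forall>j<k. s (ord j) = 0" "?a = stage_value I bd ord k t"
    | "\<not> (\<forall>j<k. s (ord j) = 0)"
    using arm_value_ge[of "stage_value I bd ord k" t I bd "ord k" "s (ord k)"] by fastforce
  then show ?case
  proof cases
    case 1
    then have "?a = mean_gain I bd (ord k) (s (ord k)) +
        (\<Sum>v<num_states I (ord k). trans_prob I (ord k) (s (ord k)) v *
           arm_value I bd (ord k) (stage_value I bd ord k) (t - 1) v)"
      by (auto simp: t mean_gain_def distrib_left sum.distrib max_def split: if_splits)
    moreover have "pick_arm I bd ord t s (Suc k) = ord k" using 1 by simp
    moreover have "progress_value I bd ord t s (Suc k) = ?a" using 1 by simp
    ultimately have "?B (Suc k)" using 1(1) by (intro exI[of _ k]) (simp only: lessI simp_thms)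
    then show ?thesis ..
  next
    case 2
    then have eq: "progress_value I bd ord t s (Suc k) = progress_value I bd ord t s k"
      "pick_arm I bd ord t s (Suc k) = pick_arm I bd ord t s k"
      using progress_value_untouched[of k s ord I bd t] by auto
    show ?thesis using Suc.IH unfolding eq by (elim disj_forward ex_forward) auto
  next
    case 3
    then have eq: "progress_value I bd ord t s (Suc k) = progress_value I bd ord t s k"
      "pick_arm I bd ord t s (Suc k) = pick_arm I bd ord t s k"
      by auto
    show ?thesis using Suc.IH unfolding eq by (elim disj_forward ex_forward) auto
  qed
qed simp

lemma pick_arm_less:
  assumes "\<And>q. q < n \<Longrightarrow> ord q < n" "0 < n" "k \<le> n"
  shows "pick_arm I bd ord t s k < n"
  using assms(3) by (induction k) (use assms in auto)

lemma sequential_policy_in_policies: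
  assumes "\<And>q. q < arms I \<Longrightarrow> ord q < arms I" "0 < arms I"
  shows "sequential_policy I bd ord \<in> policies I"
  using pick_arm_less[OF assms] by (auto simp: policies_def sequential_policy_def)


section \<open>Additive functionals of a policy\<close>

text \<open>Expected total of \<open>f i u\<close> over all plays, where \<open>i\<close> is the arm played and \<open>u\<close> its state.\<close>

primrec play_total ::
  "bandit \<Rightarrow> (nat \<Rightarrow> nat \<Rightarrow> real) \<Rightarrow> policy \<Rightarrow> nat \<Rightarrow> (nat \<Rightarrow> nat) \<Rightarrow> (nat \<Rightarrow> real) \<Rightarrow> real" where
  "play_total I f \<pi> 0 s b = 0"
| "play_total I f \<pi> (Suc t) s b =
     (let i = \<pi> (Suc t) s b in f i (s i) + (\<Sum>v<num_states I i. trans_prob I i (s i) v *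
        play_total I f \<pi> t (s(i := v)) (b(i := b i - min (b i) (outcome I i (s i) v)))))"

text \<open>An expected number of plays, but also a probability: along a run of a graded bandit each
  play takes its arm one level deeper, so a state is played at most once.\<close>

definition play_prob :: "bandit \<Rightarrow> policy \<Rightarrow> nat \<Rightarrow> nat \<Rightarrow> real" where
  "play_prob I \<pi> i u =
     play_total I (\<lambda>j v. of_bool (j = i \<and> v = u)) \<pi> (horizon I) (\<lambda>_. 0) (budget I)"

text \<open>Collects what the comparison needs of Bayesian updating: \<open>dep\<close> will be the
  number of observations, \<open>bd\<close> the remaining budget. The restriction to depths below
  the horizon has two sources: further down the successors of a state need not exhaust all outcomes,
  and the budgets computed by the machine are only guaranteed up to depth
  \<open>horizon I\<close>.\<close>

locale graded_bandit =
  fixes I :: bandit and dep :: "nat \<Rightarrow> nat \<Rightarrow> nat" and bd :: "nat \<Rightarrow> nat \<Rightarrow> real"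
  assumes states_pos: "i < arms I \<Longrightarrow> 0 < num_states I i"
    and prob_nonneg: "\<lbrakk>i < arms I; u < num_states I i; v < num_states I i\<rbrakk> \<Longrightarrow> 0 \<le> trans_prob I i u v"
    and dep_root: "i < arms I \<Longrightarrow> dep i 0 = 0"
    and dep_edge: "\<lbrakk>i < arms I; u < num_states I i; v < num_states I i; 0 < trans_prob I i u v\<rbrakk>
      \<Longrightarrow> dep i v = Suc (dep i u)"
    and prob_sum: "\<lbrakk>i < arms I; u < num_states I i; dep i u < horizon I\<rbrakk>
      \<Longrightarrow> (\<Sum>v<num_states I i. trans_prob I i u v) = 1"
    and bd_root: "i < arms I \<Longrightarrow> bd i 0 = budget I i"
    and bd_edge: "\<lbrakk>i < arms I; u < num_states I i; v < num_states I i; 0 < trans_prob I i u v;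
        dep i u < horizon I\<rbrakk> \<Longrightarrow> bd i v = bd i u - min (bd i u) (outcome I i u v)"
    and gain_nonneg: "\<lbrakk>i < arms I; u < num_states I i; dep i u < horizon I\<rbrakk> \<Longrightarrow> 0 \<le> mean_gain I bd i u"
    and gain_supermartingale: "\<lbrakk>i < arms I; u < num_states I i; Suc (dep i u) < horizon I\<rbrakk>
      \<Longrightarrow> (\<Sum>v<num_states I i. trans_prob I i u v * mean_gain I bd i v) \<le> mean_gain I bd i u"
begin

abbreviation "n \<equiv> arms I"
abbreviation "T \<equiv> horizon I"
abbreviation "N \<equiv> num_states I"
abbreviation "P \<equiv> trans_prob I"
abbreviation "r \<equiv> mean_gain I bd"

text \<open>The depth bound is imposed on every arm separately; with \<open>t > 0\<close> steps left
  it puts whichever arm is played below depth \<open>T\<close>, where the laws of the locale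
  apply.\<close>

definition consistent :: "nat \<Rightarrow> (nat \<Rightarrow> nat) \<Rightarrow> (nat \<Rightarrow> real) \<Rightarrow> bool" where
  "consistent t s b \<longleftrightarrow> (\<forall>i<n. s i < N i \<and> dep i (s i) + t \<le> T \<and> b i = bd i (s i))"

lemma consistent_init: "consistent T (\<lambda>_. 0) (budget I)"
  by (auto simp: consistent_def states_pos dep_root bd_root)

lemma consistent_step:
  assumes "consistent (Suc t) s b" "i < n" "v < N i" "P i (s i) v \<noteq> 0"
  shows "consistent t (s(i := v)) (b(i := b i - min (b i) (outcome I i (s i) v)))"
proof -
  have *: "s i < N i" "dep i (s i) + Suc t \<le> T" "b i = bd i (s i)"
    using assms by (auto simp: consistent_def)
  then have "0 < P i (s i) v" using prob_nonneg[of i "s i" v] assms by simp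
  then have "dep i v = Suc (dep i (s i))" "bd i v = bd i (s i) - min (bd i (s i)) (outcome I i (s i) v)"
    using dep_edge[of i "s i" v] bd_edge[of i "s i" v] assms * by auto
  then show ?thesis using assms * by (auto simp: consistent_def)
qed

text \<open>Common induction step of the estimates below. A comparison on consistent successors
  suffices, because the others have probability 0.\<close>

lemma play_total_mono_step:
  assumes c: "consistent (Suc t) s b" and i: "i < n"
    and le: "\<And>s b. consistent t s b \<Longrightarrow> F s b \<le> G s b"
  shows "(\<Sum>v<N i. P i (s i) v * F (s(i := v)) (b(i := b i - min (b i) (outcome I i (s i) v))))
    \<le> (\<Sum>v<N i. P i (s i) v * (G (s(i := v)) (b(i := b i - min (b i) (outcome I i (s i) v))) :: real))"
proof (rule sum_mono)
  fix v assume v: "v \<in> {..<N i}"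
  have "s i < N i" using c i by (auto simp: consistent_def)
  then have "0 \<le> P i (s i) v" using prob_nonneg i v by simp
  then show "P i (s i) v * F (s(i := v)) (b(i := b i - min (b i) (outcome I i (s i) v)))
    \<le> P i (s i) v * G (s(i := v)) (b(i := b i - min (b i) (outcome I i (s i) v)))"
    using le[OF consistent_step[OF c i]] v
    by (cases "P i (s i) v = 0") (auto intro: mult_left_mono)
qed

lemma play_total_nonneg:
  assumes \<pi>: "\<pi> \<in> policies I"
    and f: "\<And>i u. \<lbrakk>i < n; u < N i; dep i u < T\<rbrakk> \<Longrightarrow> 0 \<le> f i u"
  shows "consistent t s b \<Longrightarrow> 0 \<le> play_total I f \<pi> t s b"
proof (induction t arbitrary: s b)
  case (Suc t)
  define i where "i = \<pi> (Suc t) s b"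
  have i: "i < n" using \<pi> by (simp add: i_def policies_def)
  have "0 \<le> f i (s i)" using Suc.prems i by (intro f) (auto simp: consistent_def)
  moreover have "0 \<le> (\<Sum>v<N i. P i (s i) v *
      play_total I f \<pi> t (s(i := v)) (b(i := b i - min (b i) (outcome I i (s i) v))))"
    using play_total_mono_step[OF Suc.prems i, of "\<lambda>_ _. 0"] Suc.IH by simp
  ultimately show ?case by (simp add: Let_def flip: i_def)
qed simp

text \<open>Linearity in \<open>f\<close>: it is a combination of indicators of single states, and
  the recursion commutes with finite sums.\<close>

lemma play_total_occupation:
  assumes \<pi>: "\<pi> \<in> policies I"
  shows "consistent t s b \<Longrightarrow> play_total I f \<pi> t s b =
    (\<Sum>i<n. \<Sum>u<N i. f i u * play_total I (\<lambda>j v. of_bool (j = i \<and> v = u)) \<pi> t s b)"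
proof (induction t arbitrary: s b)
  case (Suc t)
  define i where "i = \<pi> (Suc t) s b"
  have i: "i < n" using \<pi> by (simp add: i_def policies_def)
  have si: "s i < N i" using Suc.prems i by (auto simp: consistent_def)
  define Z where "Z j u v = play_total I (\<lambda>j' v. of_bool (j' = j \<and> v = u)) \<pi> t (s(i := v))
    (b(i := b i - min (b i) (outcome I i (s i) v)))" for j u v
  have "(\<Sum>v<N i. P i (s i) v *
      play_total I f \<pi> t (s(i := v)) (b(i := b i - min (b i) (outcome I i (s i) v))))
    = (\<Sum>v<N i. P i (s i) v * (\<Sum>j<n. \<Sum>u<N j. f j u * Z j u v))"
  proof (rule sum.cong[OF refl])
    fix v assume v: "v \<in> {..<N i}"
    show "P i (s i) v * play_total I f \<pi> t (s(i := v)) (b(i := b i - min (b i) (outcome I i (s i) v)))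
      = P i (s i) v * (\<Sum>j<n. \<Sum>u<N j. f j u * Z j u v)"
    proof (cases "P i (s i) v = 0")
      case False
      have "v < N i" using v by simp
      from Suc.IH[OF consistent_step[OF Suc.prems i this False]] show ?thesis
        by (simp only: Z_def)
    qed simp
  qed
  also have "\<dots> = (\<Sum>v<N i. \<Sum>j<n. \<Sum>u<N j. f j u * (P i (s i) v * Z j u v))"
    by (simp add: sum_distrib_left mult_ac)
  also have "\<dots> = (\<Sum>j<n. \<Sum>v<N i. \<Sum>u<N j. f j u * (P i (s i) v * Z j u v))"
    by (rule sum.swap)
  also have "\<dots> = (\<Sum>j<n. \<Sum>u<N j. \<Sum>v<N i. f j u * (P i (s i) v * Z j u v))"
    by (intro sum.cong refl sum.swap)
  finally have 1: "(\<Sum>v<N i. P i (s i) v *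
      play_total I f \<pi> t (s(i := v)) (b(i := b i - min (b i) (outcome I i (s i) v))))
    = (\<Sum>j<n. \<Sum>u<N j. f j u * (\<Sum>v<N i. P i (s i) v * Z j u v))"
    by (simp add: sum_distrib_left)
  have "(\<Sum>j<n. \<Sum>u<N j. f j u * of_bool (i = j \<and> s i = u)) =
      (\<Sum>j<n. if j = i then \<Sum>u<N j. if u = s i then f i (s i) else 0 else 0)"
    by (intro sum.cong refl) (auto intro!: sum.neutral sum.cong)
  also have "\<dots> = f i (s i)"
    using i si by simp
  finally have 2: "(\<Sum>j<n. \<Sum>u<N j. f j u * of_bool (i = j \<and> s i = u)) = f i (s i)" .
  have "play_total I f \<pi> (Suc t) s b =
      f i (s i) + (\<Sum>j<n. \<Sum>u<N j. f j u * (\<Sum>v<N i. P i (s i) v * Z j u v))"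
    by (simp only: play_total.simps Let_def 1 i_def[symmetric])
  also have "\<dots> = (\<Sum>j<n. \<Sum>u<N j. f j u * of_bool (i = j \<and> s i = u)) +
      (\<Sum>j<n. \<Sum>u<N j. f j u * (\<Sum>v<N i. P i (s i) v * Z j u v))"
    by (simp only: 2)
  also have "\<dots> = (\<Sum>j<n. \<Sum>u<N j.
      f j u * play_total I (\<lambda>j' v. of_bool (j' = j \<and> v = u)) \<pi> (Suc t) s b)"
    by (simp add: Let_def Z_def distrib_left sum.distrib flip: i_def)
  finally show ?case .
qed simp

lemma play_total_one_le:
  assumes \<pi>: "\<pi> \<in> policies I"
  shows "consistent t s b \<Longrightarrow> play_total I (\<lambda>_ _. 1) \<pi> t s b \<le> real t"
proof (induction t arbitrary: s b)
  case (Suc t)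
  define i where "i = \<pi> (Suc t) s b"
  have i: "i < n" using \<pi> by (simp add: i_def policies_def)
  have "(\<Sum>v<N i. P i (s i) v *
      play_total I (\<lambda>_ _. 1) \<pi> t (s(i := v)) (b(i := b i - min (b i) (outcome I i (s i) v))))
      \<le> (\<Sum>v<N i. P i (s i) v * real t)"
    using play_total_mono_step[OF Suc.prems i, of _ "\<lambda>_ _. real t"] Suc.IH by simp
  also have "\<dots> = real t"
    using prob_sum[of i "s i"] Suc.prems i by (auto simp: consistent_def simp flip: sum_distrib_right)
  finally show ?case by (simp add: Let_def flip: i_def)
qed simp

text \<open>A play of arm \<open>j\<close> in state \<open>w\<close> requires that \<open>j\<close>
  started in \<open>w\<close> or that an earlier play of \<open>j\<close> moved it there. Only an
  inequality holds, since the arm may reach \<open>w\<close> and never be played again.\<close>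

lemma play_total_flow:
  assumes \<pi>: "\<pi> \<in> policies I" and j: "j < n" and w: "w < N j"
  shows "consistent t s b \<Longrightarrow> play_total I (\<lambda>i v. of_bool (i = j \<and> v = w)) \<pi> t s b \<le>
    of_bool (s j = w) +
    (\<Sum>u<N j. play_total I (\<lambda>i v. of_bool (i = j \<and> v = u)) \<pi> t s b * P j u w)"
proof (induction t arbitrary: s b)
  case (Suc t)
  define i where "i = \<pi> (Suc t) s b"
  have i: "i < n" using \<pi> by (simp add: i_def policies_def)
  have si: "s i < N i" "s j < N j" "dep i (s i) < T"
    using Suc.prems i j by (auto simp: consistent_def)
  define Z where "Z u v = play_total I (\<lambda>i v. of_bool (i = j \<and> v = u)) \<pi> t (s(i := v))
    (b(i := b i - min (b i) (outcome I i (s i) v)))" for u v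
  have Z: "play_total I (\<lambda>i v. of_bool (i = j \<and> v = u)) \<pi> (Suc t) s b =
      of_bool (i = j \<and> s i = u) + (\<Sum>v<N i. P i (s i) v * Z u v)" for u
    by (simp add: Let_def Z_def flip: i_def)
  have "(\<Sum>v<N i. P i (s i) v * Z w v) \<le>
      (\<Sum>v<N i. P i (s i) v * (of_bool ((s(i := v)) j = w) + (\<Sum>u<N j. Z u v * P j u w)))"
    unfolding Z_def by (rule play_total_mono_step[OF Suc.prems i Suc.IH])
  also have "\<dots> = (\<Sum>v<N i. P i (s i) v * of_bool ((s(i := v)) j = w)) +
      (\<Sum>v<N i. \<Sum>u<N j. P i (s i) v * Z u v * P j u w)"
    by (simp add: distrib_left sum.distrib sum_distrib_left mult.assoc)
  also have "(\<Sum>v<N i. \<Sum>u<N j. P i (s i) v * Z u v * P j u w) =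
      (\<Sum>u<N j. (\<Sum>v<N i. P i (s i) v * Z u v) * P j u w)"
    by (subst sum.swap) (simp add: sum_distrib_right)
  \<comment> \<open>If \<open>j\<close> itself is played, its move to \<open>w\<close> is charged to
    the term \<open>u = s j\<close> of the flow; otherwise \<open>j\<close> stays where it is and
    the probabilities of the move of \<open>i\<close> sum to 1.\<close>
  also have "(\<Sum>v<N i. P i (s i) v * of_bool ((s(i := v)) j = w)) =
      (if i = j then P j (s j) w else of_bool (s j = w))"
  proof (cases "i = j")
    case True
    then have "(\<Sum>v<N i. P i (s i) v * of_bool ((s(i := v)) j = w)) =
        (\<Sum>v<N j. if v = w then P j (s j) w else 0)"
      by (intro sum.cong) auto
    then show ?thesis using True w by simp
  next
    case False
    then show ?thesis using prob_sum[OF i si(1) si(3)] by (simp flip: sum_distrib_right)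
  qed
  finally have 1: "(\<Sum>v<N i. P i (s i) v * Z w v) \<le> (if i = j then P j (s j) w else of_bool (s j = w)) +
      (\<Sum>u<N j. (\<Sum>v<N i. P i (s i) v * Z u v) * P j u w)" .
  have "(\<Sum>u<N j. of_bool (i = j \<and> s i = u) * P j u w) =
      (\<Sum>u<N j. if u = s j then of_bool (i = j) * P j (s j) w else 0)"
    by (intro sum.cong) auto
  also have "\<dots> = of_bool (i = j) * P j (s j) w" using si by simp
  finally show ?case using 1 unfolding Z
    by (cases "i = j") (auto simp: distrib_right sum.distrib)
qed simp

lemma play_total_deep:
  assumes \<pi>: "\<pi> \<in> policies I" and j: "j < n" "T \<le> dep j w"
  shows "consistent t s b \<Longrightarrow> play_total I (\<lambda>i v. of_bool (i = j \<and> v = w)) \<pi> t s b = 0"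
proof (induction t arbitrary: s b)
  case (Suc t)
  define i where "i = \<pi> (Suc t) s b"
  have i: "i < n" using \<pi> by (simp add: i_def policies_def)
  have "dep i (s i) < T" using Suc.prems i by (auto simp: consistent_def)
  then have ne: "\<not> (i = j \<and> s i = w)" using j by auto
  have "(\<Sum>v<N i. P i (s i) v * play_total I (\<lambda>i v. of_bool (i = j \<and> v = w)) \<pi> t (s(i := v))
      (b(i := b i - min (b i) (outcome I i (s i) v)))) = 0"
    using Suc.IH[OF consistent_step[OF Suc.prems i]] by (intro sum.neutral) fastforce
  then show ?case using ne by (simp add: Let_def flip: i_def)
qed simp


section \<open>Truncation\<close>

lemma sum_by_depth:
  fixes f :: "nat \<Rightarrow> real"
  assumes "\<And>u. u < N i \<Longrightarrow> T \<le> dep i u \<Longrightarrow> f u = 0"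
  shows "(\<Sum>k<T. \<Sum>u<N i. if dep i u = k then f u else 0) = (\<Sum>u<N i. f u)"
proof -
  have "(\<Sum>k<T. \<Sum>u<N i. if dep i u = k then f u else 0) =
      (\<Sum>u<N i. \<Sum>k<T. if dep i u = k then f u else 0)"
    by (rule sum.swap)
  also have "\<dots> = (\<Sum>u<N i. f u)"
    using assms by (intro sum.cong refl) (auto simp: sum.delta')
  finally show ?thesis .
qed

text \<open>Since the mean gain is a supermartingale and playing on is optional, the expected gain of the
  \<open>k\<close>-th play decreases in \<open>k\<close>; so the first \<open>t\<close> of the \<open>T\<close> plays are worth at least the fraction
  \<open>t / T\<close> of the total.\<close>

lemma arm_value_truncation:
  assumes i: "i < n" and T: "0 < T" and t: "t \<le> T"
    and z: "\<And>u. u < N i \<Longrightarrow> 0 \<le> z u"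
    and flow: "\<And>w. w < N i \<Longrightarrow> z w \<le> of_bool (w = 0) + (\<Sum>u<N i. z u * P i u w)"
    and deep: "\<And>u. u < N i \<Longrightarrow> T \<le> dep i u \<Longrightarrow> z u = 0"
    and \<alpha>: "0 \<le> \<alpha>" and H: "\<And>t. t \<le> T \<Longrightarrow> \<alpha> * real t - \<beta> \<le> H t"
  shows "(\<alpha> + (\<Sum>u<N i. z u * r i u) / real T) * real t - (\<beta> + \<alpha> * (\<Sum>u<N i. z u))
    \<le> arm_value I bd i H t 0"
proof -
  \<comment> \<open>With \<open>z\<close> read as an occupation vector, \<open>layer k f\<close> is
    the expected value of \<open>f\<close> at play number \<open>k\<close> of the arm, counted from
    0, where runs without such a play contribute 0.\<close>
  define layer where "layer k f = (\<Sum>u<N i. if dep i u = k then z u * f u else 0)" for k and f :: "nat \<Rightarrow> real"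
  \<comment> \<open>Mass that stops after layer \<open>k\<close> is missing on the left; this is
    harmless because \<open>f\<close> is nonnegative.\<close>
  have flow_layer: "layer (Suc k) f \<le> layer k (\<lambda>u. \<Sum>v<N i. P i u v * f v)"
    if f: "\<And>v. v < N i \<Longrightarrow> dep i v = Suc k \<Longrightarrow> 0 \<le> f v" for k f
  proof -
    have "layer (Suc k) f \<le> (\<Sum>v<N i. \<Sum>u<N i. if dep i u = k then z u * (P i u v * f v) else 0)"
      unfolding layer_def
    proof (rule sum_mono)
      fix v assume v: "v \<in> {..<N i}"
      have edge: "P i u v = 0 \<or> dep i v = Suc (dep i u)" if "u < N i" for u
        using prob_nonneg[OF i that, of v] dep_edge[OF i that, of v] v by fastforce
      show "(if dep i v = Suc k then z v * f v else 0) \<le>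
          (\<Sum>u<N i. if dep i u = k then z u * (P i u v * f v) else 0)"
      proof (cases "dep i v = Suc k")
        case True
        then have "v \<noteq> 0" using dep_root[OF i] by (metis nat.distinct(1))
        then have "z v * f v \<le> (\<Sum>u<N i. z u * P i u v) * f v"
          using flow[of v] f[of v] v True by (auto intro: mult_right_mono)
        also have "\<dots> = (\<Sum>u<N i. if dep i u = k then z u * (P i u v * f v) else 0)"
          unfolding sum_distrib_right using edge True by (intro sum.cong refl) auto
        finally show ?thesis using True by simp
      next
        case False
        then have "(\<Sum>u<N i. if dep i u = k then z u * (P i u v * f v) else 0) = 0"
          using edge by (intro sum.neutral) auto
        then show ?thesis using False by simp
      qed
    qed
    also have "\<dots> = (\<Sum>u<N i. \<Sum>v<N i. if dep i u = k then z u * (P i u v * f v) else 0)"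
      by (rule sum.swap)
    also have "\<dots> = layer k (\<lambda>u. \<Sum>v<N i. P i u v * f v)"
      unfolding layer_def by (intro sum.cong refl) (simp add: sum_distrib_left)
    finally show ?thesis .
  qed
  have layer_mono: "layer k f \<le> layer k g"
    if "\<And>u. u < N i \<Longrightarrow> dep i u = k \<Longrightarrow> f u \<le> g u" for k f g
    unfolding layer_def using that z by (intro sum_mono) (auto intro: mult_left_mono)
  have layer_add: "layer k (\<lambda>u. f u + g u) = layer k f + layer k g" for k f g
    unfolding layer_def sum.distrib[symmetric] by (intro sum.cong refl) (simp add: distrib_left)
  have layer_const: "layer k (\<lambda>u. f u - c) = layer k f - c * layer k (\<lambda>_. 1)" for k f c
    unfolding layer_def sum_distrib_left sum_subtractf[symmetric]
    by (intro sum.cong refl) (auto simp: algebra_simps)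
  \<comment> \<open>Excess over the benchmark \<alpha> t - \<beta>, which abandoning the arm is
    worth at least. Measured this way a play earns its gain minus \<alpha>, the price of the step
    that the later arms lose.\<close>
  define E where "E t u = arm_value I bd i H t u - \<alpha> * real t + \<beta>" for t u
  have E_nonneg: "0 \<le> E t u" if "t \<le> T" for t u
    using H[OF that] arm_value_ge[of H t I bd i u] by (simp add: E_def)
  have E_step: "(r i u - \<alpha>) + (\<Sum>v<N i. P i u v * E t v) \<le> E (Suc t) u"
    if "u < N i" "dep i u < T" for t u
  proof -
    have "(\<Sum>v<N i. P i u v * E t v) =
        (\<Sum>v<N i. P i u v * arm_value I bd i H t v) + (\<beta> - \<alpha> * real t) * (\<Sum>v<N i. P i u v)"
      unfolding sum_distrib_left sum.distrib[symmetric] E_def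
      by (intro sum.cong refl) (simp add: algebra_simps)
    then show ?thesis
      using arm_value_Suc_ge[of I bd i u H t] prob_sum[OF i that]
      by (simp add: E_def algebra_simps)
  qed
  \<comment> \<open>No edge enters depth 0, so the flow inequality leaves weight at most 1 on the
    root and none on other states of depth 0.\<close>
  have root: "layer 0 f \<le> f 0" if "0 \<le> f 0" for f
  proof -
    have no_edge: "P i u v = 0" if "u < N i" "v < N i" "dep i v = 0" for u v
      using prob_nonneg[OF i that(1,2)] dep_edge[OF i that(1,2)] that(3) by fastforce
    have z0: "z v \<le> of_bool (v = 0)" if "v < N i" "dep i v = 0" for v
      using flow[OF that(1)] no_edge[OF _ that] by simp
    have "layer 0 f \<le> (\<Sum>u<N i. if u = 0 then f 0 else 0)"
      unfolding layer_def
    proof (rule sum_mono)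
      fix u assume u: "u \<in> {..<N i}"
      show "(if dep i u = 0 then z u * f u else 0) \<le> (if u = 0 then f 0 else 0)"
        using z0[of u] z[of u] u \<open>0 \<le> f 0\<close> mult_right_mono[of "z 0" 1 "f 0"] dep_root[OF i]
        by (cases "u = 0") auto
    qed
    then show ?thesis using states_pos[OF i] by simp
  qed
  \<comment> \<open>Imitate \<open>z\<close> for \<open>l\<close> plays; where \<open>z\<close>
    stops earlier, the excess kept by abandoning is nonnegative and is discarded.\<close>
  have unroll: "(\<Sum>k<l. layer k (\<lambda>u. r i u - \<alpha>)) + layer l (E (t - l)) \<le> E t 0" if "l \<le> t" for l
    using that
  proof (induction l)
    case 0
    then show ?case using root[of "E t"] E_nonneg[of t 0] t by simp
  next
    case (Suc l)
    have "layer (Suc l) (E (t - Suc l)) \<le> layer l (\<lambda>u. \<Sum>v<N i. P i u v * E (t - Suc l) v)"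
      using t by (intro flow_layer E_nonneg) auto
    then have "layer l (\<lambda>u. r i u - \<alpha>) + layer (Suc l) (E (t - Suc l)) \<le>
        layer l (\<lambda>u. (r i u - \<alpha>) + (\<Sum>v<N i. P i u v * E (t - Suc l) v))"
      by (simp add: layer_add)
    also have "\<dots> \<le> layer l (E (t - l))"
    proof (rule layer_mono)
      fix u assume "u < N i" "dep i u = l"
      moreover have "t - l = Suc (t - Suc l)" using Suc.prems by simp
      ultimately show "(r i u - \<alpha>) + (\<Sum>v<N i. P i u v * E (t - Suc l) v) \<le> E (t - l) u"
        using E_step[of u "t - Suc l"] Suc.prems t by simp
    qed
    finally show ?case using Suc by simp
  qed
  have "0 \<le> layer t (E 0)"
    unfolding layer_def using z E_nonneg[of 0] by (intro sum_nonneg) auto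
  then have 1: "(\<Sum>k<t. layer k (\<lambda>u. r i u - \<alpha>)) \<le> E t 0" using unroll[of t] by simp
  have "real t * (\<Sum>k<T. layer k (r i)) \<le> real T * (\<Sum>k<t. layer k (r i))"
  proof (rule antimono_prefix_average[OF _ t])
    fix k assume k: "Suc k < T"
    have "layer (Suc k) (r i) \<le> layer k (\<lambda>u. \<Sum>v<N i. P i u v * r i v)"
      using k i by (intro flow_layer gain_nonneg) auto
    also have "\<dots> \<le> layer k (r i)"
      using k i by (intro layer_mono gain_supermartingale) auto
    finally show "layer (Suc k) (r i) \<le> layer k (r i)" .
  qed
  moreover have "(\<Sum>k<T. layer k (r i)) = (\<Sum>u<N i. z u * r i u)"
    unfolding layer_def by (rule sum_by_depth) (simp add: deep)
  ultimately have 2: "(\<Sum>u<N i. z u * r i u) / real T * real t \<le> (\<Sum>k<t. layer k (r i))"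
    using T by (simp add: field_simps)
  \<comment> \<open>Charging \<alpha> for all plays of \<open>z\<close> instead of the first
    \<open>t\<close> layers makes the loss independent of \<open>t\<close>, as the form \<alpha> t -
    \<beta> requires.\<close>
  have "(\<Sum>k<t. layer k (\<lambda>_. 1)) \<le> (\<Sum>k<T. layer k (\<lambda>_. 1))"
    using t z by (intro sum_mono2) (auto simp: layer_def intro!: sum_nonneg)
  also have "\<dots> = (\<Sum>u<N i. z u)"
    unfolding layer_def using sum_by_depth[of i "\<lambda>u. z u * 1"] deep by simp
  finally have 3: "\<alpha> * (\<Sum>k<t. layer k (\<lambda>_. 1)) \<le> \<alpha> * (\<Sum>u<N i. z u)"
    using \<alpha> by (rule mult_left_mono)
  show ?thesis
    using 1 2 3 unfolding layer_const sum_subtractf sum_distrib_left[symmetric] E_def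
    by (simp add: algebra_simps)
qed

text \<open>Putting arm \<open>ord q\<close> in front of the arms below \<open>q\<close> keeps the
  bound linear in \<open>t\<close>: its reward per step is added to the slope, and each of its
  \<open>M (ord q)\<close> expected plays costs the old slope. Larger indices are played earlier, so
  the delay of \<open>ord j\<close> is caused by the \<open>ord k\<close> with
  \<open>k > j\<close>.\<close>

lemma stage_value_lower_bound:
  assumes T: "0 < T" and ord: "\<And>q. q < n \<Longrightarrow> ord q < n"
    and z: "\<And>i u. i < n \<Longrightarrow> u < N i \<Longrightarrow> 0 \<le> z i u"
    and flow: "\<And>i w. i < n \<Longrightarrow> w < N i \<Longrightarrow> z i w \<le> of_bool (w = 0) + (\<Sum>u<N i. z i u * P i u w)"
    and deep: "\<And>i u. i < n \<Longrightarrow> u < N i \<Longrightarrow> T \<le> dep i u \<Longrightarrow> z i u = 0"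
  defines "R \<equiv> \<lambda>i. \<Sum>u<N i. z i u * r i u" and "M \<equiv> \<lambda>i. \<Sum>u<N i. z i u"
  shows "q \<le> n \<Longrightarrow> t \<le> T \<Longrightarrow>
    (\<Sum>j<q. R (ord j)) / real T * real t - (\<Sum>k<q. (\<Sum>j<k. R (ord j)) / real T * M (ord k))
      \<le> stage_value I bd ord q t"
proof (induction q arbitrary: t)
  case (Suc q)
  have R: "0 \<le> R i" if "i < n" for i
    unfolding R_def
  proof (rule sum_nonneg)
    fix u assume u: "u \<in> {..<N i}"
    show "0 \<le> z i u * r i u"
      using gain_nonneg[OF that, of u] deep[OF that, of u] z[OF that, of u] u
      by (cases "dep i u < T") auto
  qed
  have "((\<Sum>j<q. R (ord j)) / real T + (\<Sum>u<N (ord q). z (ord q) u * r (ord q) u) / real T) * real t -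
      ((\<Sum>k<q. (\<Sum>j<k. R (ord j)) / real T * M (ord k)) +
        (\<Sum>j<q. R (ord j)) / real T * (\<Sum>u<N (ord q). z (ord q) u))
      \<le> arm_value I bd (ord q) (stage_value I bd ord q) t 0"
  proof (rule arm_value_truncation)
    show "0 \<le> (\<Sum>j<q. R (ord j)) / real T"
      using Suc.prems R ord by (intro divide_nonneg_nonneg sum_nonneg) auto
  qed (use Suc T ord z flow deep in auto)
  then show ?case by (simp add: R_def M_def add_divide_distrib)
qed simp

theorem play_total_le_both_orders:
  assumes \<pi>: "\<pi> \<in> policies I"
  shows "play_total I r \<pi> T (\<lambda>_. 0) (budget I) \<le>
    stage_value I bd (\<lambda>q. q) n T + stage_value I bd (\<lambda>q. n - Suc q) n T"
\<comment> \<open>The rates \<open>R i / T\<close> need a positive horizon.\<close>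
proof (cases "T = 0")
  case True
  then show ?thesis by (simp add: stage_value_time_0)
next
  case False
  then have T: "0 < T" by simp
  define z where "z = play_prob I \<pi>"
  define R M where "R i = (\<Sum>u<N i. z i u * r i u)" and "M i = (\<Sum>u<N i. z i u)" for i
  have z: "0 \<le> z i u" for i u
    unfolding z_def play_prob_def by (rule play_total_nonneg[OF \<pi> _ consistent_init]) simp
  have flow: "z i w \<le> of_bool (w = 0) + (\<Sum>u<N i. z i u * P i u w)" if "i < n" "w < N i" for i w
    using play_total_flow[OF \<pi> that consistent_init] by (simp add: z_def play_prob_def eq_commute[of 0 w])
  have deep: "z i u = 0" if "i < n" "T \<le> dep i u" for i u
    using play_total_deep[OF \<pi> that consistent_init] by (simp add: z_def play_prob_def)
  have R_nonneg: "0 \<le> R i" if "i < n" for i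
    unfolding R_def
  proof (rule sum_nonneg)
    fix u assume u: "u \<in> {..<N i}"
    show "0 \<le> z i u * r i u"
      using gain_nonneg[OF that, of u] deep[OF that, of u] z[of i u] u
      by (cases "dep i u < T") auto
  qed
  have total: "play_total I r \<pi> T (\<lambda>_. 0) (budget I) = (\<Sum>i<n. R i)"
    using play_total_occupation[OF \<pi> consistent_init, of r]
    by (simp add: R_def z_def play_prob_def mult.commute)
  have plays: "(\<Sum>i<n. M i) \<le> real T"
    using play_total_occupation[OF \<pi> consistent_init, of "\<lambda>_ _. 1"]
      play_total_one_le[OF \<pi> consistent_init]
    by (simp add: M_def z_def play_prob_def)
  have bound: "(\<Sum>j<n. R (ord j)) - (\<Sum>k<n. (\<Sum>j<k. R (ord j)) * M (ord k)) / real T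
      \<le> stage_value I bd ord n T" if "\<And>q. q < n \<Longrightarrow> ord q < n" for ord
  proof -
    have "(\<Sum>j<n. R (ord j)) / real T * real T - (\<Sum>k<n. (\<Sum>j<k. R (ord j)) / real T * M (ord k))
        \<le> stage_value I bd ord n T"
      unfolding R_def M_def
      by (rule stage_value_lower_bound) (use T that z flow deep in auto)
    moreover have "(\<Sum>k<n. (\<Sum>j<k. R (ord j)) / real T * M (ord k)) =
        (\<Sum>k<n. (\<Sum>j<k. R (ord j)) * M (ord k)) / real T"
      unfolding sum_divide_distrib[of _ "{..<n}"] by (intro sum.cong refl) simp
    ultimately show ?thesis using T by simp
  qed
  have "(\<Sum>k<n. (\<Sum>j<k. R j) * M k) + (\<Sum>k<n. (\<Sum>j<k. R (n - Suc j)) * M (n - Suc k))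
      \<le> (\<Sum>i<n. R i) * (\<Sum>i<n. M i)"
  proof -
    \<comment> \<open>The diagonal, an arm delaying itself, occurs in neither order and is
      discarded.\<close>
    have "0 \<le> (\<Sum>k<n. R k * M k)"
      using R_nonneg z by (intro sum_nonneg mult_nonneg_nonneg) (auto simp: M_def intro: sum_nonneg)
    then show ?thesis using sum_both_triangles[where a = R and b = M and m = n] by linarith
  qed
  also have "\<dots> \<le> (\<Sum>i<n. R i) * real T"
    using plays R_nonneg by (intro mult_left_mono sum_nonneg) auto
  finally have "(\<Sum>k<n. (\<Sum>j<k. R j) * M k) / real T +
      (\<Sum>k<n. (\<Sum>j<k. R (n - Suc j)) * M (n - Suc k)) / real T \<le> (\<Sum>i<n. R i)"
    using T by (simp add: pos_divide_le_eq flip: add_divide_distrib)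
  moreover have "(\<Sum>j<n. R (n - Suc j)) = (\<Sum>j<n. R j)"
    by (rule sum.nat_diff_reindex)
  ultimately show ?thesis
    using bound[of "\<lambda>q. q"] bound[of "\<lambda>q. n - Suc q"] unfolding total by simp
qed

text \<open>At every consistent position the potential \<open>progress_value\<close> is a lower
  bound for the future reward, and at the start it equals the stage value. Injectivity of
  \<open>ord\<close> keeps a play from moving the arms that are still to come off their
  roots.\<close>

theorem sequential_policy_attains_stage_value:
  assumes ord: "\<And>q. q < n \<Longrightarrow> ord q < n" and inj: "inj_on ord {..<n}" and n: "0 < n"
  shows "stage_value I bd ord n T \<le>
    play_total I r (sequential_policy I bd ord) T (\<lambda>_. 0) (budget I)"
proof -
  let ?\<pi> = "sequential_policy I bd ord"
  have \<pi>: "?\<pi> \<in> policies I" using ord n by (rule sequential_policy_in_policies)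
  have "progress_value I bd ord t s n \<le> play_total I r ?\<pi> t s b" if "consistent t s b" for t s b
    using that
  proof (induction t arbitrary: s b)
    case 0
    then show ?case by (simp add: progress_value_time_0)
  next
    case (Suc t)
    show ?case
    proof (cases "progress_value I bd ord (Suc t) s n \<le> 0")
      case True
      also have "0 \<le> play_total I r ?\<pi> (Suc t) s b"
        by (rule play_total_nonneg[OF \<pi> gain_nonneg Suc.prems])
      finally show ?thesis .
    next
      case False
      then obtain q where q: "q < n" "pick_arm I bd ord (Suc t) s n = ord q" "\<forall>j<q. s (ord j) = 0"
        and val: "progress_value I bd ord (Suc t) s n = r (ord q) (s (ord q)) +
          (\<Sum>v<N (ord q). P (ord q) (s (ord q)) v *
             arm_value I bd (ord q) (stage_value I bd ord q) t v)"
        using pick_arm_attains_progress_value[of "Suc t" I bd ord s n] by auto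
      define i where "i = ord q"
      have i: "i < n" using ord q by (simp add: i_def)
      have si: "s i < N i" using Suc.prems i by (auto simp: consistent_def)
      have "(\<Sum>v<N i. P i (s i) v * arm_value I bd i (stage_value I bd ord q) t v) =
          (\<Sum>v<N i. P i (s i) v * progress_value I bd ord t (s(i := v)) n)"
      proof (rule sum.cong[OF refl])
        fix v assume v: "v \<in> {..<N i}"
        show "P i (s i) v * arm_value I bd i (stage_value I bd ord q) t v =
          P i (s i) v * progress_value I bd ord t (s(i := v)) n"
        proof (cases "0 < P i (s i) v")
          case True
          \<comment> \<open>A play takes the arm to positive depth, off its root, which is how it is
            recognised as the arm in progress at the next step.\<close>
          then have "v \<noteq> 0" using dep_edge[OF i si _ True] dep_root[OF i] v by (metis lessThan_iff nat.distinct(1))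
          moreover have "(s(i := v)) (ord j) = 0" if "j < q" for j
            using inj_onD[OF inj, of j q] q that by (auto simp: i_def)
          ultimately have "progress_value I bd ord t (s(i := v)) n =
              arm_value I bd (ord q) (stage_value I bd ord q) t ((s(i := v)) (ord q))"
            using q by (intro progress_value_touched) (auto simp: i_def)
          then show ?thesis by (simp add: i_def)
        next
          case False
          then have "P i (s i) v = 0" using prob_nonneg[OF i si, of v] v by auto
          then show ?thesis by simp
        qed
      qed
      also have "\<dots> \<le> (\<Sum>v<N i. P i (s i) v *
          play_total I r ?\<pi> t (s(i := v)) (b(i := b i - min (b i) (outcome I i (s i) v))))"
        by (rule play_total_mono_step[OF Suc.prems i Suc.IH])
      finally have "(\<Sum>v<N i. P i (s i) v * arm_value I bd i (stage_value I bd ord q) t v) \<le> \<dots>" .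
      moreover have "?\<pi> (Suc t) s b = i" using q by (simp add: sequential_policy_def i_def)
      ultimately show ?thesis using val by (simp add: Let_def flip: i_def)
    qed
  qed
  from this[OF consistent_init] show ?thesis
    using progress_value_untouched[of n "\<lambda>_. 0" ord I bd T] by simp
qed

end

section \<open>Posteriors and expected rewards\<close>

text \<open>Marginal likelihood: the prior probability of seeing \<open>obs\<close> in a fixed
  order, and the normalising constant of \<open>posterior\<close>.\<close>

definition evidence :: "real measure measure \<Rightarrow> real multiset \<Rightarrow> real" where
  "evidence M obs = (\<integral>D. likelihood obs D \<partial>M)"

lemma likelihood_empty [simp]: "likelihood {#} D = 1"
  by (simp add: likelihood_def)

lemma likelihood_add_mset [simp]: "likelihood (add_mset x obs) D = measure D {x} * likelihood obs D"
  by (simp add: likelihood_def)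

lemma likelihood_nonneg: "0 \<le> likelihood obs D"
  by (induction obs) auto

locale reward_prior =
  fixes M :: "real measure measure"
  assumes prior: "M \<in> space (prob_algebra (prob_algebra borel))"
begin

sublocale prob_space M
  using prior by (simp add: space_prob_algebra)

lemma sets_prior [measurable_cong]: "sets M = sets (prob_algebra borel)"
  using prior by (simp add: space_prob_algebra)

lemma prob_space_reward: "D \<in> space M \<Longrightarrow> prob_space D"
  and sets_reward: "D \<in> space M \<Longrightarrow> sets D = sets borel"
  using sets_eq_imp_space_eq[OF sets_prior] by (auto simp: space_prob_algebra)

lemma measurable_point [measurable]: "(\<lambda>D. measure D {x :: real}) \<in> borel_measurable M"
  by measurable

lemma measurable_likelihood [measurable]: "likelihood obs \<in> borel_measurable M"
proof (induction obs)
  case empty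
  have "likelihood {#} = (\<lambda>_. 1)" by auto
  then show ?case by simp
next
  case (add x obs)
  note [measurable] = add
  have "likelihood (add_mset x obs) = (\<lambda>D. measure D {x} * likelihood obs D)" by auto
  then show ?case by simp
qed

lemma likelihood_le_1: "D \<in> space M \<Longrightarrow> likelihood obs D \<le> 1"
proof (induction obs)
  case (add x obs)
  then show ?case
    using prob_space.prob_le_1[OF prob_space_reward, of D "{x}"]
    by (simp add: mult_le_one likelihood_nonneg)
qed simp

lemma integrable_likelihood: "integrable M (likelihood obs)"
  by (rule integrable_const_bound[of _ 1])
     (auto intro!: AE_I2 simp: likelihood_nonneg likelihood_le_1)

lemma evidence_empty: "evidence M {#} = 1"
  by (simp add: evidence_def prob_space)

text \<open>Bayes' rule as a quotient of marginal likelihoods. Multiplying by the evidence turns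
  statements about posteriors into integrals over the prior.\<close>

lemma predictive_eq:
  assumes "0 < evidence M obs"
  shows "predictive M obs x = evidence M (add_mset x obs) / evidence M obs"
proof -
  have nn: "(\<integral>\<^sup>+D. ennreal (likelihood obs D) \<partial>M) = ennreal (evidence M obs)"
    unfolding evidence_def
    by (rule nn_integral_eq_integral[OF integrable_likelihood]) (simp add: likelihood_nonneg)
  have "posterior M obs = density M (\<lambda>D. ennreal (likelihood obs D / evidence M obs))"
    using assms by (simp add: posterior_def nn divide_ennreal likelihood_nonneg)
  then have "predictive M obs x = (\<integral>D. (likelihood obs D / evidence M obs) *\<^sub>R measure D {x} \<partial>M)"
    unfolding predictive_def using assms
    by (simp only:) (rule integral_density, auto simp: likelihood_nonneg)
  also have "\<dots> = (\<integral>D. likelihood (add_mset x obs) D / evidence M obs \<partial>M)"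
    by (simp add: mult.commute)
  also have "\<dots> = evidence M (add_mset x obs) / evidence M obs"
    by (simp add: evidence_def)
  finally show ?thesis .
qed

text \<open>A negative point has measure 0 under almost every reward distribution, which would make
  the evidence vanish.\<close>

lemma observed_reward_nonneg:
  assumes nonneg: "AE D in M. AE x in D. 0 \<le> x" and pos: "0 < evidence M (add_mset x obs)"
  shows "0 \<le> x"
proof (rule ccontr)
  assume "\<not> 0 \<le> x"
  have "AE D in M. likelihood (add_mset x obs) D = 0"
    using nonneg AE_space
  proof eventually_elim
    case (elim D)
    then have "{x} \<in> sets D" using sets_reward by simp
    moreover have "AE y in D. y \<notin> {x}" using elim(1) \<open>\<not> 0 \<le> x\<close> by (auto elim: eventually_mono)
    ultimately have "emeasure D {x} = 0"
      using AE_iff_measurable[of "{x}" D "\<lambda>y. y \<notin> {x}"] sets.sets_into_space[of "{x}" D] by auto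
    then show ?case by (simp add: measure_def)
  qed
  then have "evidence M (add_mset x obs) = 0"
    unfolding evidence_def by (rule integral_eq_zero_AE)
  then show False using pos by simp
qed

lemma sum_points_le_1:
  assumes "D \<in> space M" "finite Y"
  shows "(\<Sum>y\<in>Y. measure D {y}) \<le> 1"
proof -
  interpret D: prob_space D using assms by (simp add: prob_space_reward)
  have "(\<Sum>y\<in>Y. measure D {y}) = measure D Y"
    using assms by (intro D.finite_measure_eq_sum_singleton[symmetric]) (auto simp: sets_reward)
  then show ?thesis by simp
qed

text \<open>For a fixed reward distribution the two rewards are i.i.d., so the expected capped
  reward does not change after the first one, except through the smaller budget; averaging over the
  posterior preserves this.\<close>

lemma gain_tower:
  assumes pos: "0 < evidence M obs" and Y: "finite Y" "\<And>y. y \<in> Y \<Longrightarrow> 0 \<le> y"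
    and pred_pos: "\<And>y. y \<in> Y \<Longrightarrow> 0 < predictive M obs y"
    and total: "(\<Sum>y\<in>Y. predictive M obs y) = 1"
    and Z: "\<And>y. y \<in> Y \<Longrightarrow> finite (Z y)"
    and b: "0 \<le> b" "\<And>y. y \<in> Y \<Longrightarrow> b' y \<le> b"
  shows "(\<Sum>y\<in>Y. predictive M obs y * (\<Sum>w\<in>Z y. predictive M (add_mset y obs) w * min (b' y) w))
    \<le> (\<Sum>y\<in>Y. predictive M obs y * min b y)"
proof -
  let ?e = "evidence M obs"
  let ?m = "\<lambda>D. \<Sum>y\<in>Y. measure D {y} * min b y"
  have e1: "predictive M obs y * ?e = evidence M (add_mset y obs)" for y
    using predictive_eq[OF pos, of y] pos by simp
  have pos1: "0 < evidence M (add_mset y obs)" if "y \<in> Y" for y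
    using e1[of y] pred_pos[OF that] pos by (metis mult_pos_pos)
  have e2: "predictive M obs y * ?e * predictive M (add_mset y obs) w =
      evidence M (add_mset w (add_mset y obs))" if "y \<in> Y" for y w
    using predictive_eq[OF pos1[OF that], of w] pos1[OF that] unfolding e1 by simp
  have int1: "integrable M (\<lambda>D. \<Sum>y\<in>Y. c y * likelihood (add_mset y obs) D)" for c
    by (intro Bochner_Integration.integrable_sum integrable_mult_right integrable_likelihood)
  have int2: "integrable M (\<lambda>D. \<Sum>y\<in>Y. \<Sum>w\<in>Z y. likelihood (add_mset w (add_mset y obs)) D * min (b' y) w)"
    by (intro Bochner_Integration.integrable_sum integrable_mult_left integrable_likelihood)
  have "(\<integral>D. likelihood obs D - (\<Sum>y\<in>Y. likelihood (add_mset y obs) D) \<partial>M)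
      = ?e - (\<Sum>y\<in>Y. evidence M (add_mset y obs))"
    unfolding evidence_def
    by (subst Bochner_Integration.integral_diff)
       (use int1[of "\<lambda>_. 1"] in \<open>auto simp del: likelihood_add_mset
          intro: integrable_likelihood simp: Bochner_Integration.integral_sum[OF integrable_likelihood]\<close>)
  also have "\<dots> = ?e * (1 - (\<Sum>y\<in>Y. predictive M obs y))"
    by (simp add: right_diff_distrib sum_distrib_left e1[symmetric] mult.commute)
  finally have "(\<integral>D. likelihood obs D * (1 - (\<Sum>y\<in>Y. measure D {y})) \<partial>M) = 0"
    by (simp add: total right_diff_distrib sum_distrib_left mult.commute)
  moreover have "integrable M (\<lambda>D. likelihood obs D * (1 - (\<Sum>y\<in>Y. measure D {y})))"
    using int1[of "\<lambda>_. 1"]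
    by (simp add: right_diff_distrib sum_distrib_left mult.commute integrable_likelihood)
  moreover have "AE D in M. 0 \<le> likelihood obs D * (1 - (\<Sum>y\<in>Y. measure D {y}))"
    using sum_points_le_1 Y by (intro AE_I2 mult_nonneg_nonneg likelihood_nonneg) simp
  \<comment> \<open>Since the predictive probabilities of \<open>Y\<close> already sum to 1, almost
    every distribution of positive likelihood is concentrated on \<open>Y\<close>; points of
    \<open>Z y\<close> outside \<open>Y\<close> then have measure 0.\<close>
  ultimately have supp: "AE D in M. likelihood obs D * (1 - (\<Sum>y\<in>Y. measure D {y})) = 0"
    by (simp add: integral_nonneg_eq_0_iff_AE)
  have "?e * (\<Sum>y\<in>Y. predictive M obs y * (\<Sum>w\<in>Z y. predictive M (add_mset y obs) w * min (b' y) w))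
      = (\<Sum>y\<in>Y. \<Sum>w\<in>Z y. evidence M (add_mset w (add_mset y obs)) * min (b' y) w)"
    unfolding sum_distrib_left by (intro sum.cong refl) (simp add: e2[symmetric] mult_ac)
  also have "\<dots> = (\<integral>D. (\<Sum>y\<in>Y. \<Sum>w\<in>Z y. likelihood (add_mset w (add_mset y obs)) D * min (b' y) w) \<partial>M)"
    unfolding evidence_def
    by (subst Bochner_Integration.integral_sum Bochner_Integration.integral_mult_left,
        (intro Bochner_Integration.integrable_sum integrable_mult_left integrable_likelihood))+ (simp del: likelihood_add_mset)
  \<comment> \<open>Both sides are now integrals over the prior, and the inequality is proved for
    almost every \<open>D\<close> separately.\<close>
  also have "\<dots> \<le> (\<integral>D. (\<Sum>y\<in>Y. min b y * likelihood (add_mset y obs) D) \<partial>M)"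
  proof (rule integral_mono_AE[OF int2 int1], use supp AE_space in eventually_elim)
    case (elim D)
    show ?case
    proof (cases "likelihood obs D = 0")
      case False
      then have one: "(\<Sum>y\<in>Y. measure D {y}) = 1" using elim by simp
      have m_nonneg: "0 \<le> ?m D" using Y b by (intro sum_nonneg) auto
      have inner: "(\<Sum>w\<in>Z y. measure D {w} * min (b' y) w) \<le> ?m D" if y: "y \<in> Y" for y
      proof -
        have zero: "measure D {w} = 0" if "w \<notin> Y" for w
        proof -
          have "(\<Sum>y\<in>insert w Y. measure D {y}) \<le> 1"
            using elim Y by (intro sum_points_le_1) auto
          then show ?thesis using one that Y by (simp add: order_antisym)
        qed
        have "(\<Sum>w\<in>Z y. measure D {w} * min (b' y) w) = (\<Sum>w\<in>Z y \<inter> Y. measure D {w} * min (b' y) w)"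
          using Z[OF y] zero by (intro sum.mono_neutral_right) auto
        also have "\<dots> \<le> (\<Sum>w\<in>Z y \<inter> Y. measure D {w} * min b w)"
          using b(2)[OF y] by (intro sum_mono mult_left_mono) auto
        also have "\<dots> \<le> ?m D"
          using Y b by (intro sum_mono2) auto
        finally show ?thesis .
      qed
      have "(\<Sum>y\<in>Y. measure D {y} * (\<Sum>w\<in>Z y. measure D {w} * min (b' y) w)) \<le> (\<Sum>y\<in>Y. measure D {y} * ?m D)"
        by (intro sum_mono mult_left_mono inner) auto
      also have "\<dots> = ?m D" using one by (simp flip: sum_distrib_right)
      finally have "likelihood obs D * (\<Sum>y\<in>Y. measure D {y} * (\<Sum>w\<in>Z y. measure D {w} * min (b' y) w))
          \<le> likelihood obs D * ?m D"
        by (rule mult_left_mono) (rule likelihood_nonneg)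
      then show ?thesis by (simp add: sum_distrib_left mult_ac)
    qed simp
  qed
  also have "\<dots> = (\<Sum>y\<in>Y. min b y * evidence M (add_mset y obs))"
    unfolding evidence_def
    by (subst Bochner_Integration.integral_sum) (auto simp del: likelihood_add_mset intro!: integrable_mult_right integrable_likelihood)
  also have "\<dots> = ?e * (\<Sum>y\<in>Y. predictive M obs y * min b y)"
    unfolding sum_distrib_left by (intro sum.cong refl) (simp add: e1[symmetric] mult_ac)
  finally show ?thesis using pos by (simp add: mult_le_cancel_left_pos)
qed

end

text \<open>Every state is reachable, and along an edge the evidence is multiplied by the positive
  \<open>P u v\<close>, starting from 1 at the root. So it is positive everywhere, no posterior is
  normalised by 0, and observed rewards are nonnegative.\<close>

lemma posterior_space_unfold:
  assumes "posterior_space M T N P X" and M: "M \<in> space (prob_algebra (prob_algebra borel))"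
    and nonneg: "AE D in M. AE x in D. 0 \<le> x"
  obtains obs where "obs 0 = {#}"
    and "\<And>u. u < N \<Longrightarrow> 0 < evidence M (obs u)"
    and "\<And>u v. \<lbrakk>u < N; v < N; 0 < P u v\<rbrakk> \<Longrightarrow> obs v = add_mset (X u v) (obs u)"
    and "\<And>u v. \<lbrakk>u < N; v < N; 0 < P u v\<rbrakk> \<Longrightarrow> P u v = predictive M (obs u) (X u v)"
    and "\<And>u v. \<lbrakk>u < N; v < N; 0 < P u v\<rbrakk> \<Longrightarrow> evidence M (obs v) = P u v * evidence M (obs u)"
    and "\<And>u v. \<lbrakk>u < N; v < N; 0 < P u v\<rbrakk> \<Longrightarrow> 0 \<le> X u v"
    and "\<And>u. u < N \<Longrightarrow> size (obs u) < T \<Longrightarrow> (\<Sum>v<N. P u v) = 1"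
proof -
  interpret reward_prior M by standard (rule M)
  obtain obs where root: "obs 0 = {#}"
    and edge: "\<And>u v. \<lbrakk>u < N; v < N; 0 < P u v\<rbrakk> \<Longrightarrow>
      obs v = add_mset (X u v) (obs u) \<and> P u v = predictive M (obs u) (X u v)"
    and total: "\<And>u. u < N \<Longrightarrow> size (obs u) < T \<Longrightarrow> (\<Sum>v<N. P u v) = 1"
    and reach: "\<And>u. u < N \<Longrightarrow> (0, u) \<in> {(a, b). a < N \<and> b < N \<and> 0 < P a b}\<^sup>*"
    using assms(1) unfolding posterior_space_def by blast
  have ev: "evidence M (obs v) = P u v * evidence M (obs u)"
    if "u < N" "v < N" "0 < P u v" "0 < evidence M (obs u)" for u v
    using edge[OF that(1-3)] predictive_eq[OF that(4), of "X u v"] that(4) by simp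
  have pos: "0 < evidence M (obs u)" if "u < N" for u
    using reach[OF that]
  proof induction
    case base
    then show ?case by (simp add: root evidence_empty)
  next
    case (step u v)
    then show ?case using ev[of u v] by simp
  qed
  have "0 \<le> X u v" if "u < N" "v < N" "0 < P u v" for u v
    using observed_reward_nonneg[OF nonneg, of "X u v" "obs u"] edge[OF that] pos[OF that(2)] by simp
  then show ?thesis using that[of obs] root edge total pos ev by blast
qed

text \<open>\<open>gain_tower\<close> speaks of outcomes, the graph of states. Successors of a state
  carry distinct outcomes, so sums over successors can be reindexed by the observed rewards.\<close>

lemma posterior_space_supermartingale:
  assumes ps: "posterior_space M T N P X" and M: "M \<in> space (prob_algebra (prob_algebra borel))"
    and obs: "\<And>u v. \<lbrakk>u < N; v < N; 0 < P u v\<rbrakk> \<Longrightarrow> obs v = add_mset (X u v) (obs u)"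
      "\<And>u v. \<lbrakk>u < N; v < N; 0 < P u v\<rbrakk> \<Longrightarrow> P u v = predictive M (obs u) (X u v)"
      "\<And>u v. \<lbrakk>u < N; v < N; 0 < P u v\<rbrakk> \<Longrightarrow> 0 \<le> X u v"
    and u: "u < N" "0 < evidence M (obs u)" "(\<Sum>v<N. P u v) = 1"
    and b: "0 \<le> b u" "\<And>v. \<lbrakk>v < N; 0 < P u v\<rbrakk> \<Longrightarrow> b v \<le> b u"
  shows "(\<Sum>v<N. P u v * (\<Sum>w<N. P v w * min (b v) (X v w))) \<le> (\<Sum>v<N. P u v * min (b u) (X u v))"
proof -
  interpret reward_prior M by standard (rule M)
  define C where "C v = {w. w < N \<and> 0 < P v w}" for v
  have P_nonneg: "\<And>u v. u < N \<Longrightarrow> v < N \<Longrightarrow> 0 \<le> P u v"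
    and inj: "\<And>v. v < N \<Longrightarrow> inj_on (X v) (C v)"
    using ps by (auto simp: posterior_space_def C_def)
  have C: "finite (C v)" "C v \<subseteq> {..<N}" for v by (auto simp: C_def)
  have restrict: "(\<Sum>w<N. P v w * f w) = (\<Sum>w\<in>C v. P v w * f w)" if "v < N" for v and f :: "nat \<Rightarrow> real"
    using that P_nonneg[OF that] by (intro sum.mono_neutral_right) (force simp: C_def)+
  have by_outcome: "(\<Sum>w\<in>C v. P v w * f w) = (\<Sum>x\<in>X v ` C v. predictive M (obs v) x * f (inv_into (C v) (X v) x))"
    if "v < N" for v f
    using inj[OF that] obs(2)[OF that] by (simp add: sum.reindex C_def)
  define h where "h = inv_into (C u) (X u)"
  have h: "h y \<in> C u" "X u (h y) = y" if "y \<in> X u ` C u" for y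
    using that by (auto simp: h_def inv_into_into f_inv_into_f)
  have Cu: "v < N" "0 < P u v" "obs v = add_mset (X u v) (obs u)" if "v \<in> C u" for v
    using that obs(1)[OF u(1)] by (auto simp: C_def)
  have "(\<Sum>v<N. P u v * (\<Sum>w<N. P v w * min (b v) (X v w))) =
      (\<Sum>y\<in>X u ` C u. predictive M (obs u) y * (\<Sum>w<N. P (h y) w * min (b (h y)) (X (h y) w)))"
    unfolding restrict[OF u(1)] by_outcome[OF u(1)] h_def ..
  also have "\<dots> = (\<Sum>y\<in>X u ` C u. predictive M (obs u) y *
      (\<Sum>x\<in>X (h y) ` C (h y). predictive M (add_mset y (obs u)) x * min (b (h y)) x))"
  proof (intro sum.cong refl arg_cong2[where f = "(*)"])
    fix y assume y: "y \<in> X u ` C u"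
    have v: "h y < N" using h(1)[OF y] Cu by auto
    have "obs (h y) = add_mset y (obs u)" using Cu(3)[OF h(1)[OF y]] h(2)[OF y] by simp
    then show "(\<Sum>w<N. P (h y) w * min (b (h y)) (X (h y) w)) =
        (\<Sum>x\<in>X (h y) ` C (h y). predictive M (add_mset y (obs u)) x * min (b (h y)) x)"
      unfolding restrict[OF v] by_outcome[OF v]
      by (intro sum.cong refl) (simp add: f_inv_into_f)
  qed
  also have "\<dots> \<le> (\<Sum>y\<in>X u ` C u. predictive M (obs u) y * min (b u) y)"
  proof (rule gain_tower)
    show "(\<Sum>y\<in>X u ` C u. predictive M (obs u) y) = 1"
      using u(3) restrict[OF u(1), of "\<lambda>_. 1"] by_outcome[OF u(1), of "\<lambda>_. 1"] by simp
    show "0 < predictive M (obs u) y" if "y \<in> X u ` C u" for y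
      using that obs(2)[OF u(1)] by (auto simp: C_def)
    show "0 \<le> y" if "y \<in> X u ` C u" for y
      using that obs(3)[OF u(1)] by (auto simp: C_def)
    show "b (h y) \<le> b u" if "y \<in> X u ` C u" for y
      using b(2) Cu(1,2)[OF h(1)[OF that]] by simp
  qed (use C u b in auto)
  also have "\<dots> = (\<Sum>v<N. P u v * min (b u) (X u v))"
    unfolding restrict[OF u(1)] by_outcome[OF u(1)]
    by (intro sum.cong refl) (simp add: f_inv_into_f)
  finally show ?thesis .
qed

section \<open>Expected reward as an additive functional\<close>

context graded_bandit
begin

text \<open>The reward for fixed \<open>D\<close> is weighted with the likelihood of all
  observations so far; its integral is the evidence of these observations times
  \<open>play_total\<close>. A play multiplies the weights by matching factors,
  \<open>measure (D i) {x}\<close> under the integral and the predictive probability outside. At the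
  root both weights are 1.\<close>

lemma expected_reward_eq_play_total:
  assumes n: "0 < n" and prior: "\<And>i. i < n \<Longrightarrow> prior i \<in> space (prob_algebra (prob_algebra borel))"
    and obs_root: "\<And>i. i < n \<Longrightarrow> obs i 0 = {#}"
    and obs_edge: "\<And>i u v. \<lbrakk>i < n; u < N i; v < N i; 0 < P i u v\<rbrakk> \<Longrightarrow>
      obs i v = add_mset (outcome I i u v) (obs i u)"
    and evidence_edge: "\<And>i u v. \<lbrakk>i < n; u < N i; v < N i; 0 < P i u v\<rbrakk> \<Longrightarrow>
      evidence (prior i) (obs i v) = P i u v * evidence (prior i) (obs i u)"
    and \<pi>: "\<pi> \<in> policies I"
  shows "expected_reward I prior \<pi> = play_total I r \<pi> T (\<lambda>_. 0) (budget I)"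
proof -
  have prior': "reward_prior (prior i)" if "i < n" for i using prior[OF that] by unfold_locales
  \<comment> \<open>Indices beyond the last arm are filled with copies of the first prior, since the
    product locale asks for a measure at every index.\<close>
  define M where "M i = prior (if i < n then i else 0)" for i
  have "reward_prior (M i)" for i unfolding M_def using prior' n by simp
  then interpret M: reward_prior "M i" for i .
  interpret product_sigma_finite M by unfold_locales
  have PiM: "PiM {..<n} prior = PiM {..<n} M" by (rule PiM_cong) (auto simp: M_def)
  define L where "L s D = (\<Prod>i<n. likelihood (obs i (s i)) (D i))" for s :: "nat \<Rightarrow> nat" and D
  define c where "c s = (\<Prod>i<n. evidence (M i) (obs i (s i)))" for s :: "nat \<Rightarrow> nat"
  \<comment> \<open>Independence of the arms enters here: the likelihood of all observations
    integrates to the product of the evidences.\<close>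
  have L_int: "integrable (PiM {..<n} M) (L s)" "(\<integral>D. L s D \<partial>PiM {..<n} M) = c s" for s
    unfolding L_def c_def evidence_def
    by (intro product_integrable_prod product_integral_prod M.integrable_likelihood finite_lessThan)+
  have "integrable (PiM {..<n} M) (\<lambda>D. L s D * reward_given I \<pi> D t s b) \<and>
      (\<integral>D. L s D * reward_given I \<pi> D t s b \<partial>PiM {..<n} M) = c s * play_total I r \<pi> t s b"
    if "consistent t s b" for t s b
    using that
  proof (induction t arbitrary: s b)
    case (Suc t)
    define i where "i = \<pi> (Suc t) s b"
    have i: "i < n" using \<pi> by (simp add: i_def policies_def)
    have si: "s i < N i" and bi: "b i = bd i (s i)" using Suc.prems i by (auto simp: consistent_def)
    define C where "C = {v. v < N i \<and> 0 < P i (s i) v}"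
    define x where "x v = outcome I i (s i) v" for v
    define s' where "s' v = s(i := v)" for v
    define b' where "b' v = b(i := b i - min (b i) (x v))" for v
    define F where "F v D = min (b i) (x v) * L (s' v) D + L (s' v) D * reward_given I \<pi> D t (s' v) (b' v)" for v D
    have upd: "(\<Prod>j<n. f j (s' v j)) = f i v * (\<Prod>j\<in>{..<n} - {i}. f j (s j))" for f :: "nat \<Rightarrow> nat \<Rightarrow> real" and v
      using i by (subst prod.remove[of _ i]) (auto simp: s'_def intro!: prod.cong)
    have same: "(\<Prod>j<n. f j (s j)) = f i (s i) * (\<Prod>j\<in>{..<n} - {i}. f j (s j))" for f :: "nat \<Rightarrow> nat \<Rightarrow> real"
      using i by (subst prod.remove[of _ i]) auto
    have L_upd: "L (s' v) D = measure (D i) {x v} * L s D" if "v \<in> C" for v D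
      using obs_edge[OF i si, of v] that
      unfolding L_def upd[of "\<lambda>j u. likelihood (obs j u) (D j)"] same[of "\<lambda>j u. likelihood (obs j u) (D j)"]
      by (simp add: C_def x_def)
    have c_upd: "c (s' v) = P i (s i) v * c s" if "v \<in> C" for v
      using evidence_edge[OF i si, of v] that i
      unfolding c_def upd[of "\<lambda>j u. evidence (M j) (obs j u)"] same[of "\<lambda>j u. evidence (M j) (obs j u)"]
      by (simp add: C_def M_def)
    have IH: "integrable (PiM {..<n} M) (\<lambda>D. L (s' v) D * reward_given I \<pi> D t (s' v) (b' v))"
      "(\<integral>D. L (s' v) D * reward_given I \<pi> D t (s' v) (b' v) \<partial>PiM {..<n} M) =
        c (s' v) * play_total I r \<pi> t (s' v) (b' v)" if "v \<in> C" for v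
      using Suc.IH[OF consistent_step[OF Suc.prems i, of v]] that
      unfolding C_def s'_def b'_def x_def by (simp_all del: fun_upd_apply)
    have F_int: "integrable (PiM {..<n} M) (F v)"
      "(\<integral>D. F v D \<partial>PiM {..<n} M) = c s * (P i (s i) v * (min (b i) (x v) + play_total I r \<pi> t (s' v) (b' v)))"
      if "v \<in> C" for v
      unfolding F_def using IH[OF that] L_int c_upd[OF that]
      by (auto simp: algebra_simps)
    have F_sum: "L s D * reward_given I \<pi> D (Suc t) s b = (\<Sum>v\<in>C. F v D)" for D
    proof -
      have "reward_given I \<pi> D (Suc t) s b =
          (\<Sum>v\<in>C. measure (D i) {x v} * (min (b i) (x v) + reward_given I \<pi> D t (s' v) (b' v)))"
        by (simp only: reward_given.simps Let_def C_def s'_def b'_def x_def flip: i_def)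
      then show ?thesis
        by (simp add: sum_distrib_left F_def L_upd algebra_simps)
    qed
    have "(\<Sum>v\<in>C. P i (s i) v * (min (b i) (x v) + play_total I r \<pi> t (s' v) (b' v))) =
        (\<Sum>v<N i. P i (s i) v * (min (b i) (x v) + play_total I r \<pi> t (s' v) (b' v)))"
      using prob_nonneg[OF i si] by (intro sum.mono_neutral_left) (force simp: C_def)+
    also have "\<dots> = r i (s i) + (\<Sum>v<N i. P i (s i) v * play_total I r \<pi> t (s' v) (b' v))"
      by (simp add: distrib_left sum.distrib mean_gain_def x_def bi)
    also have "\<dots> = play_total I r \<pi> (Suc t) s b"
      by (simp only: play_total.simps Let_def s'_def b'_def x_def flip: i_def)
    finally have play: "(\<Sum>v\<in>C. P i (s i) v * (min (b i) (x v) + play_total I r \<pi> t (s' v) (b' v))) =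
        play_total I r \<pi> (Suc t) s b" .
    show ?case
      unfolding F_sum using F_int
      by (simp add: Bochner_Integration.integral_sum play flip: sum_distrib_left)
  qed simp
  from this[OF consistent_init] have "(\<integral>D. L (\<lambda>_. 0) D * reward_given I \<pi> D T (\<lambda>_. 0) (budget I) \<partial>PiM {..<n} M) =
      c (\<lambda>_. 0) * play_total I r \<pi> T (\<lambda>_. 0) (budget I)" by simp
  moreover have "L (\<lambda>_. 0) D = 1" for D by (simp add: L_def obs_root)
  moreover have "c (\<lambda>_. 0) = 1" by (simp add: c_def obs_root M.evidence_empty)
  ultimately show ?thesis by (simp add: expected_reward_def PiM)
qed

end

text \<open>The dynamic program evaluates every state with the budget array found in memory, which
  is only known to be right up to depth \<open>horizon I\<close>. By this lemma that array is itself
  a valid \<open>bd\<close>, so the tables are exact for it and no error has to be tracked.\<close>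

lemma graded_bandit_cong:
  assumes "graded_bandit I dep bd"
    and eq: "\<And>i u. \<lbrakk>i < arms I; u < num_states I i; dep i u \<le> horizon I\<rbrakk> \<Longrightarrow> bd' i u = bd i u"
  shows "graded_bandit I dep bd'"
proof -
  interpret graded_bandit I dep bd by fact
  have gain: "mean_gain I bd' i u = mean_gain I bd i u"
    if "i < arms I" "u < num_states I i" "dep i u \<le> horizon I" for i u
    using eq[OF that] by (simp add: mean_gain_def)
  have tower: "(\<Sum>v<num_states I i. trans_prob I i u v * mean_gain I bd' i v) =
      (\<Sum>v<num_states I i. trans_prob I i u v * mean_gain I bd i v)"
    if "i < arms I" "u < num_states I i" "Suc (dep i u) < horizon I" for i u
  proof (rule sum.cong[OF refl])
    fix v assume "v \<in> {..<num_states I i}"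
    then show "trans_prob I i u v * mean_gain I bd' i v = trans_prob I i u v * mean_gain I bd i v"
      using prob_nonneg[OF that(1,2), of v] dep_edge[OF that(1,2), of v] gain[of i v] that
      by (cases "0 < trans_prob I i u v") auto
  qed
  show ?thesis
  proof
    show "(\<Sum>v<num_states I i. trans_prob I i u v) = 1"
      if "i < arms I" "u < num_states I i" "dep i u < horizon I" for i u
      using prob_sum[OF that] .
    show "bd' i v = bd' i u - min (bd' i u) (outcome I i u v)"
      if "i < arms I" "u < num_states I i" "v < num_states I i" "0 < trans_prob I i u v" "dep i u < horizon I"
      for i u v
      using bd_edge[OF that] dep_edge[OF that(1-4)] eq[of i u] eq[of i v] that by simp
    show "0 \<le> mean_gain I bd' i u" if "i < arms I" "u < num_states I i" "dep i u < horizon I" for i u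
      using gain_nonneg[OF that] gain[of i u] that by simp
    show "(\<Sum>v<num_states I i. trans_prob I i u v * mean_gain I bd' i v) \<le> mean_gain I bd' i u"
      if "i < arms I" "u < num_states I i" "Suc (dep i u) < horizon I" for i u
      using gain_supermartingale[OF that] tower[OF that] gain[of i u] that by simp
  qed (use states_pos prob_nonneg dep_root dep_edge bd_root eq in auto)
qed

text \<open>The reward formula is stated for every valid table \<open>bd'\<close>, so that it
  applies to the one computed by the machine.\<close>

theorem bayesian_bandit_is_graded:
  assumes "bayesian_bandit I prior"
  obtains dep bd where "graded_bandit I dep bd"
    and "\<And>bd' \<pi>. graded_bandit I dep bd' \<Longrightarrow> \<pi> \<in> policies I \<Longrightarrow>
      expected_reward I prior \<pi> =
        play_total I (mean_gain I bd') \<pi> (horizon I) (\<lambda>_. 0) (budget I)"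
proof -
  let ?n = "arms I" and ?N = "num_states I" and ?P = "trans_prob I" and ?X = "outcome I"
  have n: "0 < ?n"
    and prior: "\<And>i. i < ?n \<Longrightarrow> prior i \<in> space (prob_algebra (prob_algebra borel))"
    and nonneg: "\<And>i. i < ?n \<Longrightarrow> AE D in prior i. AE x in D. 0 \<le> x"
    and budget: "\<And>i. i < ?n \<Longrightarrow> 0 \<le> budget I i"
    and space: "\<And>i. i < ?n \<Longrightarrow> posterior_space (prior i) (horizon I) (?N i) (?P i) (?X i)"
    using assms by (auto simp: bayesian_bandit_def)
  define good where "good i obs \<longleftrightarrow> obs 0 = {#} \<and> (\<forall>u<?N i. 0 < evidence (prior i) (obs u)) \<and>
    (\<forall>u<?N i. \<forall>v<?N i. 0 < ?P i u v \<longrightarrow> obs v = add_mset (?X i u v) (obs u) \<and>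
       ?P i u v = predictive (prior i) (obs u) (?X i u v) \<and>
       evidence (prior i) (obs v) = ?P i u v * evidence (prior i) (obs u) \<and> 0 \<le> ?X i u v) \<and>
    (\<forall>u<?N i. size (obs u) < horizon I \<longrightarrow> (\<Sum>v<?N i. ?P i u v) = 1)" for i obs
  have "\<exists>obs. good i obs" if i: "i < ?n" for i
  proof (rule posterior_space_unfold[OF space[OF i] prior[OF i] nonneg[OF i]])
    fix obs assume "obs 0 = {#}"
      and "\<And>u. u < ?N i \<Longrightarrow> 0 < evidence (prior i) (obs u)"
      and "\<And>u v. \<lbrakk>u < ?N i; v < ?N i; 0 < ?P i u v\<rbrakk> \<Longrightarrow> obs v = add_mset (?X i u v) (obs u)"
      and "\<And>u v. \<lbrakk>u < ?N i; v < ?N i; 0 < ?P i u v\<rbrakk> \<Longrightarrow> ?P i u v = predictive (prior i) (obs u) (?X i u v)"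
      and "\<And>u v. \<lbrakk>u < ?N i; v < ?N i; 0 < ?P i u v\<rbrakk> \<Longrightarrow>
        evidence (prior i) (obs v) = ?P i u v * evidence (prior i) (obs u)"
      and "\<And>u v. \<lbrakk>u < ?N i; v < ?N i; 0 < ?P i u v\<rbrakk> \<Longrightarrow> 0 \<le> ?X i u v"
      and "\<And>u. u < ?N i \<Longrightarrow> size (obs u) < horizon I \<Longrightarrow> (\<Sum>v<?N i. ?P i u v) = 1"
    then have "good i obs" unfolding good_def by blast
    then show "\<exists>obs. good i obs" by (intro exI[of _ obs])
  qed
  then obtain obs where good: "\<And>i. i < ?n \<Longrightarrow> good i (obs i)" by metis
  define dep where "dep i u = size (obs i u)" for i u
  \<comment> \<open>The remaining budget is the initial one minus all observed rewards, cut off at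
    0. For nonnegative rewards this agrees with subtracting \<open>min b x\<close> at every
    play.\<close>
  define bd where "bd i u = max 0 (budget I i - sum_mset (obs i u))" for i u
  have P: "0 \<le> ?P i u v" "0 < ?N i" if "i < ?n" "u < ?N i" "v < ?N i" for i u v
    using space that by (auto simp: posterior_space_def)
  have edge: "obs i v = add_mset (?X i u v) (obs i u)" "?P i u v = predictive (prior i) (obs i u) (?X i u v)"
    "evidence (prior i) (obs i v) = ?P i u v * evidence (prior i) (obs i u)" "0 \<le> ?X i u v"
    if "i < ?n" "u < ?N i" "v < ?N i" "0 < ?P i u v" for i u v
    using good[OF that(1)] that unfolding good_def by blast+
  have root: "obs i 0 = {#}" if "i < ?n" for i
    using good[OF that] by (simp add: good_def)
  have bd_edge: "bd i v = bd i u - min (bd i u) (?X i u v)" if "i < ?n" "u < ?N i" "v < ?N i" "0 < ?P i u v" for i u v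
    using edge(1,4)[OF that] by (auto simp: bd_def)
  have graded: "graded_bandit I dep bd"
  proof
    show "(\<Sum>v<?N i. ?P i u v) = 1" if "i < ?n" "u < ?N i" "dep i u < horizon I" for i u
      using good[OF that(1)] that by (simp add: good_def dep_def)
    show "0 \<le> mean_gain I bd i u" if "i < ?n" "u < ?N i" for i u
      unfolding mean_gain_def
    proof (rule sum_nonneg)
      fix v assume "v \<in> {..<?N i}"
      then show "0 \<le> ?P i u v * min (bd i u) (?X i u v)"
        using P(1)[OF that, of v] edge(4)[OF that, of v] by (cases "0 < ?P i u v") (auto simp: bd_def)
    qed
    show "(\<Sum>v<?N i. ?P i u v * mean_gain I bd i v) \<le> mean_gain I bd i u"
      if "i < ?n" "u < ?N i" "Suc (dep i u) < horizon I" for i u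
      unfolding mean_gain_def
    proof (rule posterior_space_supermartingale[OF space[OF that(1)] prior[OF that(1)], where obs = "obs i"])
      show "(\<Sum>v<?N i. ?P i u v) = 1" "0 < evidence (prior i) (obs i u)"
        using good[OF that(1)] that by (simp_all add: good_def dep_def)
      show "bd i v \<le> bd i u" if v: "v < ?N i" "0 < ?P i u v" for v
        using bd_edge[OF \<open>i < ?n\<close> \<open>u < ?N i\<close> v] edge(4)[OF \<open>i < ?n\<close> \<open>u < ?N i\<close> v]
        by (auto simp: bd_def)
    qed (use edge that in \<open>auto simp: bd_def\<close>)
  qed (use P edge root bd_edge budget space in \<open>auto simp: dep_def bd_def posterior_space_def\<close>)
  show ?thesis
  proof (rule that[OF graded])
    fix bd' \<pi> assume bd': "graded_bandit I dep bd'" and \<pi>: "\<pi> \<in> policies I"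
    interpret graded_bandit I dep bd' by fact
    show "expected_reward I prior \<pi> = play_total I (mean_gain I bd') \<pi> (horizon I) (\<lambda>_. 0) (budget I)"
      by (rule expected_reward_eq_play_total[where obs = obs]) (use n prior root edge \<pi> in auto)
  qed
qed

section \<open>Bounded execution\<close>

definition runs :: "com \<Rightarrow> mem \<Rightarrow> nat \<Rightarrow> (mem \<Rightarrow> bool) \<Rightarrow> bool" where
  "runs c m K Q \<longleftrightarrow> (\<exists>k m'. k \<le> K \<and> exec c m k m' \<and> Q m')"

lemma runs_weaken: "runs c m K Q \<Longrightarrow> K \<le> K' \<Longrightarrow> (\<And>m'. Q m' \<Longrightarrow> Q' m') \<Longrightarrow> runs c m K' Q'"
  unfolding runs_def by (meson order_trans)

lemma runs_Skip: "Q m \<Longrightarrow> 0 < K \<Longrightarrow> runs Skip m K Q"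
  unfolding runs_def using exec.Skip by (metis Suc_leI One_nat_def)

lemma runs_NSet: "Q (set_nat a (map (neval m) es) (neval m e) m) \<Longrightarrow> runs (NSet a es e) m 1 Q"
  unfolding runs_def using exec.NSet by blast

lemma runs_RSet: "Q (set_real a (map (neval m) es) (reval m e) m) \<Longrightarrow> runs (RSet a es e) m 1 Q"
  unfolding runs_def using exec.RSet by blast

lemma runs_Seq:
  "runs c m K R \<Longrightarrow> (\<And>m'. R m' \<Longrightarrow> runs d m' L Q) \<Longrightarrow> runs (Seq c d) m (K + L) Q"
  unfolding runs_def by (meson exec.Seq add_mono)

lemma runs_Cond:
  assumes "beval m b \<Longrightarrow> runs c m K Q" "\<not> beval m b \<Longrightarrow> runs d m K Q"
  shows "runs (Cond b c d) m (K + 1) Q"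
  using assms unfolding runs_def
  by (cases "beval m b") (meson exec.CondTrue exec.CondFalse add_le_mono1)+

abbreviation nvar :: "string \<Rightarrow> nexp" where
  "nvar x \<equiv> NGet x []"

definition For :: "string \<Rightarrow> nexp \<Rightarrow> com \<Rightarrow> com" where
  "For x e c = Seq (NSet x [] (NConst 0))
     (While (NLess (nvar x) e) (Seq c (NSet x [] (NAdd (nvar x) (NConst 1)))))"

text \<open>\<open>Inv\<close> is required after the increment, so it may mention the counter. The
  loop bound \<open>e\<close> is evaluated at every test, hence the demand that it stay equal to
  \<open>n\<close>. The cost uses a common bound \<open>S\<close> for all loop lengths, so that
  nested loops give a polynomial in \<open>S\<close>.\<close>

lemma runs_For:
  assumes init: "Inv 0 (set_nat x [] 0 m)"
    and cnt: "\<And>j m. Inv j m \<Longrightarrow> nats m x [] = j \<and> neval m e = n"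
    and body: "\<And>j m. j < n \<Longrightarrow> Inv j m \<Longrightarrow>
      runs c m K (\<lambda>m'. nats m' x [] = j \<and> Inv (Suc j) (set_nat x [] (Suc j) m'))"
    and post: "\<And>m. Inv n m \<Longrightarrow> Q m" and n: "n \<le> S"
  shows "runs (For x e c) m ((S + 1) * (K + 2)) Q"
proof -
  let ?w = "While (NLess (nvar x) e) (Seq c (NSet x [] (NAdd (nvar x) (NConst 1))))"
  have loop: "runs ?w m ((n - j) * (K + 2) + 1) Q" if "Inv j m" "j \<le> n" for j m
    using that
  proof (induction "n - j" arbitrary: j m)
    case 0
    then have "\<not> beval m (NLess (nvar x) e)" using cnt by simp
    then have "exec ?w m 1 m" by (rule exec.WhileFalse)
    then show ?case using 0 post unfolding runs_def by auto
  next
    case (Suc d)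
    then have j: "j < n" by simp
    obtain k1 m1 where 1: "k1 \<le> K" "exec c m k1 m1" "nats m1 x [] = j"
      "Inv (Suc j) (set_nat x [] (Suc j) m1)"
      using body[OF j Suc.prems(1)] unfolding runs_def by blast
    have "runs ?w (set_nat x [] (Suc j) m1) ((n - Suc j) * (K + 2) + 1) Q"
      by (rule Suc.hyps(1)) (use Suc.hyps(2) j 1 in auto)
    then obtain k2 m2 where 2: "k2 \<le> (n - Suc j) * (K + 2) + 1"
      "exec ?w (set_nat x [] (Suc j) m1) k2 m2" "Q m2"
      unfolding runs_def by blast
    have inc: "exec (NSet x [] (NAdd (nvar x) (NConst 1))) m1 1 (set_nat x [] (Suc j) m1)"
      using exec.NSet[of x "[]" "NAdd (nvar x) (NConst 1)" m1] 1(3) by simp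
    have "beval m (NLess (nvar x) e)" using cnt[OF Suc.prems(1)] j by simp
    from exec.WhileTrue[OF this exec.Seq[OF 1(2) inc] 2(2)]
    have "exec ?w m (k1 + 1 + k2 + 1) m2" .
    moreover have "k1 + 1 + k2 + 1 \<le> (n - j) * (K + 2) + 1"
    proof -
      have "(n - j) * (K + 2) = (n - Suc j) * (K + 2) + (K + 2)"
        using j by (metis Suc_diff_Suc mult_Suc add.commute)
      then show ?thesis using 1(1) 2(1) by linarith
    qed
    ultimately show ?case using 2(3) unfolding runs_def by blast
  qed
  have "runs (For x e c) m (1 + (n * (K + 2) + 1)) Q"
    unfolding For_def
  proof (rule runs_Seq[where R = "Inv 0"])
    show "runs (NSet x [] (NConst 0)) m 1 (Inv 0)" by (rule runs_NSet) (simp add: init)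
    show "runs ?w m' (n * (K + 2) + 1) Q" if "Inv 0 m'" for m' using loop[OF that] by simp
  qed
  \<comment> \<open>A round costs the body, the increment and a test; the initial assignment and the
    last test are paid by one additional round.\<close>
  moreover have "1 + (n * (K + 2) + 1) \<le> (S + 1) * (K + 2)"
    using mult_le_mono1[OF n, of "K + 2"] by simp
  ultimately show ?thesis by (rule runs_weaken)
qed

lemma nats_set_nat [simp]: "nats (set_nat a is k m) = (nats m)(a := (nats m a)(is := k))"
  and reals_set_nat [simp]: "reals (set_nat a is k m) = reals m"
  and nats_set_real [simp]: "nats (set_real a is r m) = nats m"
  and reals_set_real [simp]: "reals (set_real a is r m) = (reals m)(a := (reals m a)(is := r))"
  by (simp_all add: set_nat_def set_real_def)

definition frame :: "string set \<Rightarrow> string set \<Rightarrow> mem \<Rightarrow> mem \<Rightarrow> bool" where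
  "frame A B m m' \<longleftrightarrow> (\<forall>a. a \<notin> A \<longrightarrow> nats m' a = nats m a) \<and> (\<forall>a. a \<notin> B \<longrightarrow> reals m' a = reals m a)"

lemma frame_nats: "frame A B m m' \<Longrightarrow> a \<notin> A \<Longrightarrow> nats m' a = nats m a"
  and frame_reals: "frame A B m m' \<Longrightarrow> a \<notin> B \<Longrightarrow> reals m' a = reals m a"
  by (auto simp: frame_def)

lemma frame_refl: "frame A B m m"
  by (simp add: frame_def)

lemma frame_trans:
  "frame A B m m' \<Longrightarrow> frame A' B' m' m'' \<Longrightarrow> A' \<subseteq> A \<Longrightarrow> B' \<subseteq> B \<Longrightarrow> frame A B m m''"
  unfolding frame_def by (metis subsetD)

lemma frame_set_nat: "frame A B m m' \<Longrightarrow> a \<in> A \<Longrightarrow> frame A B m (set_nat a is k m')"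
  and frame_set_real: "frame A B m m' \<Longrightarrow> a \<in> B \<Longrightarrow> frame A B m (set_real a is r m')"
  by (auto simp: frame_def)

text \<open>The input memory holds 0 in place of the outcome of a non-edge, hence the
  implication.\<close>

definition loaded :: "bandit \<Rightarrow> mem \<Rightarrow> bool" where
  "loaded I m \<longleftrightarrow> nats m ''arms'' [] = arms I \<and> nats m ''horizon'' [] = horizon I \<and>
     (\<forall>i<arms I. nats m ''states'' [i] = num_states I i \<and> reals m ''budget'' [i] = budget I i \<and>
       (\<forall>u<num_states I i. \<forall>v<num_states I i.
          reals m ''prob'' [i, u, v] = trans_prob I i u v \<and>
          (trans_prob I i u v \<noteq> 0 \<longrightarrow> reals m ''outcome'' [i, u, v] = outcome I i u v)))"

lemma loaded_frame:
  assumes "loaded I m" "frame A B m m'" "A \<inter> {''arms'', ''horizon'', ''states''} = {}"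
    "B \<inter> {''budget'', ''prob'', ''outcome''} = {}"
  shows "loaded I m'"
proof -
  have "nats m' a = nats m a" if "a \<in> {''arms'', ''horizon'', ''states''}" for a
    using assms that by (auto simp: frame_def)
  moreover have "reals m' a = reals m a" if "a \<in> {''budget'', ''prob'', ''outcome''}" for a
    using assms that by (auto simp: frame_def)
  ultimately show ?thesis using assms(1) unfolding loaded_def by simp
qed

lemma loaded_input_mem:
  assumes "\<And>i u v. \<lbrakk>i < arms I; u < num_states I i; v < num_states I i\<rbrakk> \<Longrightarrow> 0 \<le> trans_prob I i u v"
  shows "loaded I (input_mem I)"
  using assms by (force simp: loaded_def input_mem_def)


section \<open>Remaining budgets of the states\<close>

definition relax_edge :: com where
  "relax_edge = Cond (RLess (RConst 0) (RGet ''prob'' [nvar ''i'', nvar ''u'', nvar ''v'']))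
     (Cond (RLess (RGet ''bud'' [nvar ''i'', nvar ''u'']) (RGet ''outcome'' [nvar ''i'', nvar ''u'', nvar ''v'']))
       (RSet ''bud'' [nvar ''i'', nvar ''v''] (RConst 0))
       (RSet ''bud'' [nvar ''i'', nvar ''v'']
         (RSub (RGet ''bud'' [nvar ''i'', nvar ''u'']) (RGet ''outcome'' [nvar ''i'', nvar ''u'', nvar ''v'']))))
     Skip"

text \<open>The states are not numbered topologically; but after \<open>k\<close> rounds of relaxing all edges the
  states of depth at most \<open>k\<close> have their final value.\<close>

definition budget_prog :: com where
  "budget_prog = Seq
     (For ''i'' (nvar ''arms'') (RSet ''bud'' [nvar ''i'', NConst 0] (RGet ''budget'' [nvar ''i''])))
     (For ''k'' (nvar ''horizon'') (For ''i'' (nvar ''arms'')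
       (For ''u'' (NGet ''states'' [nvar ''i'']) (For ''v'' (NGet ''states'' [nvar ''i'']) relax_edge))))"

text \<open>Each loop contributes a factor as in \<open>runs_For\<close>; the innermost 3 is the
  longest run of \<open>relax_edge\<close>, two tests and an assignment.\<close>

definition budget_cost :: "nat \<Rightarrow> nat" where
  "budget_cost S = (S + 1) * (1 + 2) +
     (S + 1) * ((S + 1) * ((S + 1) * ((S + 1) * (3 + 2) + 2) + 2) + 2)"

context graded_bandit
begin

abbreviation "budget_frame \<equiv> frame {''k'', ''i'', ''u'', ''v''} {''bud''}"

text \<open>The situation in the middle of round \<open>k\<close>: \<open>E\<close> holds the edges
  relaxed so far in this round. Entries of depth at most \<open>k\<close> are final, and so is the
  target of an edge in \<open>E\<close> that starts at such a depth.\<close>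

definition budgets_known :: "nat \<Rightarrow> (nat \<times> nat \<times> nat) set \<Rightarrow> mem \<Rightarrow> bool" where
  "budgets_known k E m \<longleftrightarrow> (\<forall>i<n. \<forall>w<N i.
     dep i w \<le> k \<or> (\<exists>u<N i. (i, u, w) \<in> E \<and> 0 < P i u w \<and> dep i u \<le> k) \<longrightarrow>
     reals m ''bud'' [i, w] = bd i w)"

text \<open>An edge out of a state deeper than \<open>k\<close> may write a wrong value, but into an
  entry deeper than \<open>k + 1\<close>, about which nothing is claimed yet. An edge from depth at
  most \<open>k\<close> writes the right value, since all parents of a state determine the same
  remaining budget.\<close>

lemma runs_relax_edge:
  assumes "loaded I m" "budgets_known k E m" "k < T"
    and "nats m ''i'' [] = i" "nats m ''u'' [] = u" "nats m ''v'' [] = v" "i < n" "u < N i" "v < N i"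
  shows "runs relax_edge m 3 (\<lambda>m'. frame {} {''bud''} m m' \<and> budgets_known k (insert (i, u, v) E) m')"
proof -
  have prob: "reals m ''prob'' [i, u, v] = P i u v"
    and out: "0 < P i u v \<Longrightarrow> reals m ''outcome'' [i, u, v] = outcome I i u v"
    using assms by (auto simp: loaded_def)
  have known: "reals m ''bud'' [i', w] = bd i' w"
    if "i' < n" "w < N i'" "dep i' w \<le> k \<or> (\<exists>u<N i'. (i', u, w) \<in> E \<and> 0 < P i' u w \<and> dep i' u \<le> k)" for i' w
    using assms(2) that unfolding budgets_known_def by blast
  have upd: "budgets_known k (insert (i, u, v) E) (set_real ''bud'' [i, v] x m)"
    if pos: "0 < P i u v" and x: "x = reals m ''bud'' [i, u] - min (reals m ''bud'' [i, u]) (outcome I i u v)" for x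
  proof -
    have dv: "dep i v = Suc (dep i u)" using dep_edge assms pos by simp
    have x': "x = bd i v" if "dep i u \<le> k"
      using known[of i u] bd_edge[of i u v] assms pos that x by simp
    show ?thesis
      unfolding budgets_known_def
    proof (intro allI impI)
      fix i' w assume iw: "i' < n" "w < N i'"
        and c: "dep i' w \<le> k \<or> (\<exists>u'<N i'. (i', u', w) \<in> insert (i, u, v) E \<and> 0 < P i' u' w \<and> dep i' u' \<le> k)"
      have "dep i' w \<le> Suc k" using c dep_edge[OF iw(1) _ iw(2)] by fastforce
      then have "(i', w) = (i, v) \<Longrightarrow> dep i u \<le> k" using dv by simp
      moreover have "(i', w) \<noteq> (i, v) \<Longrightarrow> reals m ''bud'' [i', w] = bd i' w"
        using known[OF iw] c by auto
      ultimately show "reals (set_real ''bud'' [i, v] x m) ''bud'' [i', w] = bd i' w"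
        using x' by auto
    qed
  qed
  have skip: "budgets_known k (insert (i, u, v) E) m" if "\<not> 0 < P i u v"
    using assms(2) that unfolding budgets_known_def by auto
  have "runs relax_edge m (1 + 1 + 1) (\<lambda>m'. frame {} {''bud''} m m' \<and> budgets_known k (insert (i, u, v) E) m')"
    unfolding relax_edge_def
  proof (intro runs_Cond runs_RSet, goal_cases)
    case 1
    then show ?case using assms prob out upd[of 0] by (simp add: frame_refl frame_set_real min_def)
  next
    case 2
    then show ?case
      using assms prob out upd[of "reals m ''bud'' [i, u] - outcome I i u v"]
      by (simp add: frame_refl frame_set_real min_def)
  next
    case 3
    then show ?case
      using assms prob skip by (intro runs_Skip) (simp_all add: frame_refl)
  qed
  then show ?thesis by (simp add: numeral_3_eq_3)
qed

lemma runs_budget_prog: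
  assumes parent: "\<And>i v. \<lbrakk>i < n; v < N i; v \<noteq> 0\<rbrakk> \<Longrightarrow> \<exists>u<N i. 0 < P i u v"
    and m: "loaded I m0" and S: "n \<le> S" "T \<le> S" "\<And>i. i < n \<Longrightarrow> N i \<le> S"
  shows "runs budget_prog m0 (budget_cost S) (\<lambda>m. budget_frame m0 m \<and>
    (\<forall>i<n. \<forall>u<N i. dep i u \<le> T \<longrightarrow> reals m ''bud'' [i, u] = bd i u))"
proof -
  have load: "loaded I m" if "budget_frame m0 m" for m
    by (rule loaded_frame[OF m that]) auto
  have cnt: "nats m ''arms'' [] = n" "nats m ''horizon'' [] = T" "i < n \<Longrightarrow> nats m ''states'' [i] = N i"
    if "budget_frame m0 m" for m i
    using load[OF that] by (auto simp: loaded_def)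
  define J where "J k E m \<longleftrightarrow> budget_frame m0 m \<and> budgets_known k E m" for k E m
  have J_set: "J k E (set_nat a is x m) \<longleftrightarrow> J k E m"
    if "a \<in> {''k'', ''i'', ''u'', ''v''}" for k E m a x and "is" :: "nat list"
    using that by (auto simp: J_def frame_def budgets_known_def)
  have edge: "runs relax_edge m 3 (\<lambda>m'. nats m' = nats m \<and> J k (insert (i, u, v) E) m')"
    if "J k E m" "k < T" "nats m ''i'' [] = i" "nats m ''u'' [] = u" "nats m ''v'' [] = v"
      "i < n" "u < N i" "v < N i" for k E m i u v
  proof (rule runs_weaken[OF runs_relax_edge[OF _ _ that(2-)] order.refl])
    show "loaded I m" "budgets_known k E m" using that load by (auto simp: J_def)
    fix m' assume "frame {} {''bud''} m m' \<and> budgets_known k (insert (i, u, v) E) m'"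
    then show "nats m' = nats m \<and> J k (insert (i, u, v) E) m'"
      using that(1) frame_trans[of "{''k'', ''i'', ''u'', ''v''}" "{''bud''}" m0 m "{}" "{''bud''}" m']
      by (auto simp: J_def frame_def)
  qed
  have v_loop: "runs (For ''v'' (NGet ''states'' [nvar ''i'']) relax_edge) m ((S + 1) * (3 + 2))
      (\<lambda>m'. nats m' ''k'' = nats m ''k'' \<and> nats m' ''i'' = nats m ''i'' \<and> nats m' ''u'' = nats m ''u'' \<and>
        J k (E \<union> {(i, u, v) | v. v < N i}) m')"
    if a: "J k E m" "k < T" "nats m ''i'' [] = i" "nats m ''u'' [] = u" "i < n" "u < N i" for k E m i u
  proof (rule runs_For[where n = "N i" and Inv = "\<lambda>v m'. nats m' ''v'' [] = v \<and>
      nats m' ''k'' = nats m ''k'' \<and> nats m' ''i'' = nats m ''i'' \<and> nats m' ''u'' = nats m ''u'' \<and>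
      J k (E \<union> {(i, u, w) | w. w < v}) m'"], goal_cases)
    case 1 then show ?case using a by (simp add: J_set)
  next
    case (2 j m') then show ?case using a cnt by (simp add: J_def)
  next
    case (3 j m')
    have "E \<union> {(i, u, w) | w. w < Suc j} = insert (i, u, j) (E \<union> {(i, u, w) | w. w < j})" by auto
    then show ?case
      using 3 a by (intro runs_weaken[OF edge[of k "E \<union> {(i, u, w) | w. w < j}" m' i u j]]) (auto simp: J_set)
  next
    case (4 m') then show ?case by simp
  next
    case 5 then show ?case using S a by simp
  qed
  have u_loop: "runs (For ''u'' (NGet ''states'' [nvar ''i'']) (For ''v'' (NGet ''states'' [nvar ''i'']) relax_edge))
      m ((S + 1) * ((S + 1) * (3 + 2) + 2))
      (\<lambda>m'. nats m' ''k'' = nats m ''k'' \<and> nats m' ''i'' = nats m ''i'' \<and>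
        J k (E \<union> {(i, u, v) | u v. u < N i \<and> v < N i}) m')"
    if a: "J k E m" "k < T" "nats m ''i'' [] = i" "i < n" for k E m i
  proof (rule runs_For[where n = "N i" and Inv = "\<lambda>u m'. nats m' ''u'' [] = u \<and>
      nats m' ''k'' = nats m ''k'' \<and> nats m' ''i'' = nats m ''i'' \<and>
      J k (E \<union> {(i, u', w) | u' w. u' < u \<and> w < N i}) m'"], goal_cases)
    case 1 then show ?case using a by (simp add: J_set)
  next
    case (2 j m') then show ?case using a cnt by (simp add: J_def)
  next
    case (3 j m')
    have "E \<union> {(i, u', w) | u' w. u' < Suc j \<and> w < N i} =
        (E \<union> {(i, u', w) | u' w. u' < j \<and> w < N i}) \<union> {(i, j, w) | w. w < N i}"
      by (auto simp: less_Suc_eq)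
    then show ?case
      using 3 a by (intro runs_weaken[OF v_loop[of k "E \<union> {(i, u', w) | u' w. u' < j \<and> w < N i}" m' i j]])
        (auto simp: J_set)
  next
    case (4 m') then show ?case by simp
  next
    case 5 then show ?case using S a by simp
  qed
  have i_loop: "runs (For ''i'' (nvar ''arms'') (For ''u'' (NGet ''states'' [nvar ''i''])
        (For ''v'' (NGet ''states'' [nvar ''i'']) relax_edge)))
      m ((S + 1) * ((S + 1) * ((S + 1) * (3 + 2) + 2) + 2))
      (\<lambda>m'. nats m' ''k'' = nats m ''k'' \<and> J k {(i, u, v). i < n \<and> u < N i \<and> v < N i} m')"
    if a: "J k {} m" "k < T" for k m
  proof (rule runs_For[where n = "n" and Inv = "\<lambda>i m'. nats m' ''i'' [] = i \<and>
      nats m' ''k'' = nats m ''k'' \<and> J k {(i', u', w). i' < i \<and> u' < N i' \<and> w < N i'} m'"], goal_cases)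
    case 1
    have eq: "{(i', u', w). i' < 0 \<and> u' < N i' \<and> w < N i'} = {}" by auto
    show ?case using a unfolding eq by (simp add: J_set)
  next
    case (2 j m') then show ?case using a cnt by (simp add: J_def)
  next
    case (3 j m')
    have "{(i', u', w). i' < Suc j \<and> u' < N i' \<and> w < N i'} =
        {(i', u', w). i' < j \<and> u' < N i' \<and> w < N i'} \<union> {(j, u', w) | u' w. u' < N j \<and> w < N j}"
      by (auto simp: less_Suc_eq)
    then show ?case
      using 3 a by (intro runs_weaken[OF u_loop[of k "{(i', u', w). i' < j \<and> u' < N i' \<and> w < N i'}" m' j]])
        (auto simp: J_set)
  next
    case (4 m') then show ?case by simp
  next
    case 5 then show ?case using S a by simp
  qed
  \<comment> \<open>Every state but the root has a parent one level up, so relaxing all edges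
    settles the next depth.\<close>
  have round: "J (Suc k) {} m" if "J k {(i, u, v). i < n \<and> u < N i \<and> v < N i} m" for k m
    unfolding J_def budgets_known_def
  proof (intro conjI allI impI)
    fix i w assume iw: "i < n" "w < N i"
      and "dep i w \<le> Suc k \<or> (\<exists>u<N i. (i, u, w) \<in> {} \<and> 0 < P i u w \<and> dep i u \<le> Suc k)"
    then have d: "dep i w \<le> Suc k" by simp
    have "dep i w \<le> k \<or> (\<exists>u<N i. 0 < P i u w \<and> dep i u \<le> k)"
    proof (cases "w = 0")
      case False
      then obtain u where "u < N i" "0 < P i u w" using parent iw by blast
      then show ?thesis using dep_edge[OF iw(1) _ iw(2)] d by fastforce
    qed (simp add: dep_root iw)
    then show "reals m ''bud'' [i, w] = bd i w"
      using that iw unfolding J_def budgets_known_def by auto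
  qed (use that in \<open>simp add: J_def\<close>)
  have k_loop: "runs (For ''k'' (nvar ''horizon'') (For ''i'' (nvar ''arms'')
        (For ''u'' (NGet ''states'' [nvar ''i'']) (For ''v'' (NGet ''states'' [nvar ''i'']) relax_edge))))
      m ((S + 1) * ((S + 1) * ((S + 1) * ((S + 1) * (3 + 2) + 2) + 2) + 2)) (J T {})"
    if "J 0 {} m" for m
  proof (rule runs_For[where n = T and Inv = "\<lambda>k m'. nats m' ''k'' [] = k \<and> J k {} m'"], goal_cases)
    case 1 then show ?case using that by (simp add: J_set)
  next
    case (2 j m') then show ?case using cnt by (simp add: J_def)
  next
    case (3 j m')
    show ?case
    proof (rule runs_weaken[OF i_loop[of j m'] order.refl])
      fix m'' assume "nats m'' ''k'' = nats m' ''k'' \<and> J j {(i, u, v). i < n \<and> u < N i \<and> v < N i} m''"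
      then show "nats m'' ''k'' [] = j \<and> nats (set_nat ''k'' [] (Suc j) m'') ''k'' [] = Suc j \<and>
          J (Suc j) {} (set_nat ''k'' [] (Suc j) m'')"
        using 3 round[of j m''] by (simp add: J_set)
    qed (use 3 in auto)
  next
    case (4 m') then show ?case by simp
  next
    case 5 then show ?case using S by simp
  qed
  \<comment> \<open>Only the root has depth 0, so initialising the roots establishes the invariant
    for round 0.\<close>
  have dep_0: "w = 0" if "i < n" "w < N i" "dep i w = 0" for i w
    using parent[OF that(1,2)] dep_edge[OF that(1) _ that(2)] that(3) by (metis nat.distinct(1))
  have init: "runs (For ''i'' (nvar ''arms'') (RSet ''bud'' [nvar ''i'', NConst 0] (RGet ''budget'' [nvar ''i''])))
      m0 ((S + 1) * (1 + 2)) (J 0 {})"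
  proof (rule runs_For[where n = n and Inv = "\<lambda>i m. nats m ''i'' [] = i \<and> budget_frame m0 m \<and>
      (\<forall>j<i. reals m ''bud'' [j, 0] = budget I j)"], goal_cases)
    case 1 then show ?case by (simp add: frame_set_nat frame_refl)
  next
    case (2 j m') then show ?case using cnt by simp
  next
    case (3 j m')
    have "reals m' ''budget'' [j] = budget I j" using load[of m'] 3 by (simp add: loaded_def)
    then show ?case
      using 3 by (intro runs_RSet) (simp add: frame_set_nat frame_set_real less_Suc_eq)
  next
    case (4 m')
    have "reals m' ''bud'' [i, w] = bd i w" if "i < n" "w < N i" "dep i w = 0" for i w
      using 4 dep_0[OF that] bd_root[OF that(1)] that(1) by simp
    then show ?case using 4 by (auto simp: J_def budgets_known_def)
  next
    case 5 then show ?case using S by simp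
  qed
  have "runs budget_prog m0 (budget_cost S) (J T {})"
    unfolding budget_prog_def budget_cost_def by (rule runs_Seq[OF init k_loop])
  then show ?thesis
    by (rule runs_weaken) (auto simp: J_def budgets_known_def)
qed

end


section \<open>The dynamic program\<close>

definition arm_order :: "bandit \<Rightarrow> nat \<Rightarrow> nat \<Rightarrow> nat" where
  "arm_order I d q = (if d = 0 then q else arms I - Suc q)"

definition order_exp :: "nat \<Rightarrow> nexp" where
  "order_exp d = (if d = 0 then nvar ''q'' else NSub (nvar ''arms'') (NAdd (nvar ''q'') (NConst 1)))"

text \<open>The entry \<open>[d, q, u, t]\<close> of the array \<open>G\<close> is the value, in order \<open>d\<close> and with \<open>t\<close> steps
  left, of playing the arms \<open>arm_order I d (q - 1), \<dots>, arm_order I d 0\<close> when the first of them is in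
  state \<open>u\<close>; the entries for \<open>q = 0\<close> and \<open>t = 0\<close> are never written and keep their initial value 0.\<close>

definition expectation_prog :: "nat \<Rightarrow> com" where
  "expectation_prog d = For ''v'' (NGet ''states'' [nvar ''a''])
     (Cond (RLess (RGet ''bud'' [nvar ''a'', nvar ''u'']) (RGet ''outcome'' [nvar ''a'', nvar ''u'', nvar ''v'']))
       (RSet ''acc'' [] (RAdd (RGet ''acc'' []) (RMul (RGet ''prob'' [nvar ''a'', nvar ''u'', nvar ''v''])
         (RAdd (RGet ''bud'' [nvar ''a'', nvar ''u''])
           (RGet ''G'' [NConst d, NAdd (nvar ''q'') (NConst 1), nvar ''v'', nvar ''t''])))))
       (RSet ''acc'' [] (RAdd (RGet ''acc'' []) (RMul (RGet ''prob'' [nvar ''a'', nvar ''u'', nvar ''v''])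
         (RAdd (RGet ''outcome'' [nvar ''a'', nvar ''u'', nvar ''v''])
           (RGet ''G'' [NConst d, NAdd (nvar ''q'') (NConst 1), nvar ''v'', nvar ''t'']))))))"

definition cell_prog :: "nat \<Rightarrow> com" where
  "cell_prog d = Seq (RSet ''acc'' [] (RConst 0)) (Seq (expectation_prog d)
     (Cond (RLess (RGet ''acc'' []) (RGet ''G'' [NConst d, nvar ''q'', NConst 0, NAdd (nvar ''t'') (NConst 1)]))
       (RSet ''G'' [NConst d, NAdd (nvar ''q'') (NConst 1), nvar ''u'', NAdd (nvar ''t'') (NConst 1)]
         (RGet ''G'' [NConst d, nvar ''q'', NConst 0, NAdd (nvar ''t'') (NConst 1)]))
       (RSet ''G'' [NConst d, NAdd (nvar ''q'') (NConst 1), nvar ''u'', NAdd (nvar ''t'') (NConst 1)]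
         (RGet ''acc'' []))))"

definition row_prog :: "nat \<Rightarrow> com" where
  "row_prog d = For ''u'' (NGet ''states'' [nvar ''a'']) (cell_prog d)"

definition table_prog :: "nat \<Rightarrow> com" where
  "table_prog d = For ''q'' (nvar ''arms'')
     (Seq (NSet ''a'' [] (order_exp d)) (For ''t'' (nvar ''horizon'') (row_prog d)))"

definition cell_cost :: "nat \<Rightarrow> nat" where
  "cell_cost S = 1 + ((S + 1) * (2 + 2) + 2)"

definition table_cost :: "nat \<Rightarrow> nat" where
  "table_cost S = (S + 1) * (1 + (S + 1) * ((S + 1) * (cell_cost S + 2) + 2) + 2)"

section \<open>Correctness of the value tables\<close>

lemma runs_expectation_prog:
  assumes m: "loaded I m0" and i: "nats m0 ''a'' [] = i" "i < arms I" "num_states I i \<le> S"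
    and u: "nats m0 ''u'' [] = u" "u < num_states I i"
  shows "runs (expectation_prog d) m0 ((S + 1) * (2 + 2)) (\<lambda>m. frame {''v''} {''acc''} m0 m \<and>
    reals m ''acc'' [] = reals m0 ''acc'' [] + (\<Sum>v<num_states I i. trans_prob I i u v *
      (min (reals m0 ''bud'' [i, u]) (outcome I i u v) +
       reals m0 ''G'' [d, Suc (nats m0 ''q'' []), v, nats m0 ''t'' []])))"
  unfolding expectation_prog_def
proof (rule runs_For[where n = "num_states I i" and Inv = "\<lambda>j m. nats m ''v'' [] = j \<and>
    frame {''v''} {''acc''} m0 m \<and>
    reals m ''acc'' [] = reals m0 ''acc'' [] + (\<Sum>v<j. trans_prob I i u v *
      (min (reals m0 ''bud'' [i, u]) (outcome I i u v) +
       reals m0 ''G'' [d, Suc (nats m0 ''q'' []), v, nats m0 ''t'' []]))"], goal_cases)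
  case 1
  then show ?case by (simp add: frame_set_nat frame_refl)
next
  case (2 j m)
  then show ?case using m i by (simp add: frame_def loaded_def)
next
  case (3 j m)
  then have f: "frame {''v''} {''acc''} m0 m" by simp
  note [simp] = frame_nats[OF f] frame_reals[OF f]
  have prob: "reals m0 ''prob'' [i, u, j] = trans_prob I i u j"
    and out: "trans_prob I i u j \<noteq> 0 \<Longrightarrow> reals m0 ''outcome'' [i, u, j] = outcome I i u j"
    using m i u 3 by (auto simp: loaded_def)
  have "runs (Cond b (RSet ''acc'' [] e) (RSet ''acc'' [] e')) m (1 + 1) Q"
    if "beval m b \<Longrightarrow> Q (set_real ''acc'' [] (reval m e) m)"
      "\<not> beval m b \<Longrightarrow> Q (set_real ''acc'' [] (reval m e') m)" for b e e' Q
    using that by (intro runs_Cond runs_RSet) auto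
  note r = this[unfolded one_add_one]
  \<comment> \<open>On non-edges the stored outcome may differ from \<open>outcome I\<close>, but
    either is multiplied by 0.\<close>
  show ?case
    by (rule r; cases "trans_prob I i u j = 0")
       (use 3 i u f prob out in \<open>simp_all add: frame_set_nat frame_set_real min_def\<close>)
next
  case (4 m)
  then show ?case by simp
next
  case 5
  then show ?case using i by simp
qed

text \<open>The counters \<open>q\<close> and \<open>t\<close> start at 0, while the entry written
  is at \<open>q + 1\<close> and \<open>t + 1\<close>. It depends on the root entry of the preceding
  stage at the same time and on the entries of its own stage one step earlier.\<close>

lemma runs_cell_prog:
  assumes m: "loaded I m0" and i: "nats m0 ''a'' [] = i" "i < arms I" "num_states I i \<le> S"
    and u: "nats m0 ''u'' [] = u" "u < num_states I i"
    and q: "nats m0 ''q'' [] = q" and t: "nats m0 ''t'' [] = t"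
    and bd: "bd = (\<lambda>i u. reals m0 ''bud'' [i, u])"
    and H: "reals m0 ''G'' [d, q, 0, Suc t] = H (Suc t)"
    and G: "\<And>v. v < num_states I i \<Longrightarrow> reals m0 ''G'' [d, Suc q, v, t] = arm_value I bd i H t v"
  shows "runs (cell_prog d) m0 (cell_cost S) (\<lambda>m. frame {''v''} {''acc'', ''G''} m0 m \<and>
    reals m ''G'' = (reals m0 ''G'')([d, Suc q, u, Suc t] := arm_value I bd i H (Suc t) u))"
  unfolding cell_prog_def cell_cost_def
proof (rule runs_Seq[where R = "\<lambda>m. m = set_real ''acc'' [] 0 m0"])
  show "runs (RSet ''acc'' [] (RConst 0)) m0 1 (\<lambda>m. m = set_real ''acc'' [] 0 m0)"
    by (rule runs_RSet) simp
  fix m1 assume m1: "m1 = set_real ''acc'' [] 0 m0"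
  have "loaded I m1" using m by (auto simp: loaded_def m1)
  from runs_expectation_prog[OF this, of i S u d]
  have exp: "runs (expectation_prog d) m1 ((S + 1) * (2 + 2)) (\<lambda>m. frame {''v''} {''acc''} m1 m \<and>
      reals m ''acc'' [] = (\<Sum>v<num_states I i. trans_prob I i u v *
        (min (bd i u) (outcome I i u v) + reals m0 ''G'' [d, Suc q, v, t])))"
    using i u q t by (simp add: m1 bd)
  show "runs (Seq (expectation_prog d)
     (Cond (RLess (RGet ''acc'' []) (RGet ''G'' [NConst d, nvar ''q'', NConst 0, NAdd (nvar ''t'') (NConst 1)]))
       (RSet ''G'' [NConst d, NAdd (nvar ''q'') (NConst 1), nvar ''u'', NAdd (nvar ''t'') (NConst 1)]
         (RGet ''G'' [NConst d, nvar ''q'', NConst 0, NAdd (nvar ''t'') (NConst 1)]))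
       (RSet ''G'' [NConst d, NAdd (nvar ''q'') (NConst 1), nvar ''u'', NAdd (nvar ''t'') (NConst 1)]
         (RGet ''acc'' [])))) m1 ((S + 1) * (2 + 2) + 2) (\<lambda>m. frame {''v''} {''acc'', ''G''} m0 m \<and>
    reals m ''G'' = (reals m0 ''G'')([d, Suc q, u, Suc t] := arm_value I bd i H (Suc t) u))"
  proof (rule runs_Seq[OF exp])
    fix m assume m': "frame {''v''} {''acc''} m1 m \<and> reals m ''acc'' [] = (\<Sum>v<num_states I i.
        trans_prob I i u v * (min (bd i u) (outcome I i u v) + reals m0 ''G'' [d, Suc q, v, t]))"
    then have f: "frame {''v''} {''acc''} m1 m" by simp
    have acc: "reals m ''acc'' [] = (\<Sum>v<num_states I i. trans_prob I i u v *
        (min (bd i u) (outcome I i u v) + arm_value I bd i H t v))"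
      using m' G by simp
    have eqs: "nats m ''q'' [] = q" "nats m ''u'' [] = u" "nats m ''t'' [] = t" "reals m ''G'' = reals m0 ''G''"
      using frame_nats[OF f] frame_reals[OF f] q u t by (simp_all add: m1)
    have f': "frame {''v''} {''acc'', ''G''} m0 m"
      using f by (auto simp: frame_def m1)
    have "runs (Cond b (RSet a es e) (RSet a es e')) m (1 + 1) Q"
      if "beval m b \<Longrightarrow> Q (set_real a (map (neval m) es) (reval m e) m)"
        "\<not> beval m b \<Longrightarrow> Q (set_real a (map (neval m) es) (reval m e') m)" for a es b e e' Q
      using that by (intro runs_Cond runs_RSet) auto
    note branch = this[unfolded one_add_one]
    show "runs (Cond (RLess (RGet ''acc'' []) (RGet ''G'' [NConst d, nvar ''q'', NConst 0, NAdd (nvar ''t'') (NConst 1)]))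
       (RSet ''G'' [NConst d, NAdd (nvar ''q'') (NConst 1), nvar ''u'', NAdd (nvar ''t'') (NConst 1)]
         (RGet ''G'' [NConst d, nvar ''q'', NConst 0, NAdd (nvar ''t'') (NConst 1)]))
       (RSet ''G'' [NConst d, NAdd (nvar ''q'') (NConst 1), nvar ''u'', NAdd (nvar ''t'') (NConst 1)]
         (RGet ''acc'' []))) m 2 (\<lambda>m. frame {''v''} {''acc'', ''G''} m0 m \<and>
      reals m ''G'' = (reals m0 ''G'')([d, Suc q, u, Suc t] := arm_value I bd i H (Suc t) u))"
      by (rule branch) (use f' eqs acc H in \<open>simp_all add: frame_set_real max_def\<close>)
  qed
qed

lemma runs_row_prog:
  assumes m: "loaded I m0" and i: "nats m0 ''a'' [] = i" "i < arms I" "num_states I i \<le> S"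
    and q: "nats m0 ''q'' [] = q" and t: "nats m0 ''t'' [] = t"
    and bd: "bd = (\<lambda>i u. reals m0 ''bud'' [i, u])"
    and H: "reals m0 ''G'' [d, q, 0, Suc t] = H (Suc t)"
    and G: "\<And>v. v < num_states I i \<Longrightarrow> reals m0 ''G'' [d, Suc q, v, t] = arm_value I bd i H t v"
  shows "runs (row_prog d) m0 ((S + 1) * (cell_cost S + 2)) (\<lambda>m. frame {''u'', ''v''} {''acc'', ''G''} m0 m \<and>
    (\<forall>d' q' u t'. reals m ''G'' [d', q', u, t'] =
       (if d' = d \<and> q' = Suc q \<and> t' = Suc t \<and> u < num_states I i
        then arm_value I bd i H (Suc t) u else reals m0 ''G'' [d', q', u, t'])))"
  unfolding row_prog_def
proof (rule runs_For[where n = "num_states I i" and Inv = "\<lambda>j m. nats m ''u'' [] = j \<and>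
    frame {''u'', ''v''} {''acc'', ''G''} m0 m \<and>
    (\<forall>d' q' u t'. reals m ''G'' [d', q', u, t'] =
       (if d' = d \<and> q' = Suc q \<and> t' = Suc t \<and> u < j
        then arm_value I bd i H (Suc t) u else reals m0 ''G'' [d', q', u, t']))"], goal_cases)
  case 1
  then show ?case by (simp add: frame_set_nat frame_refl)
next
  case (2 j m)
  then show ?case using m i by (simp add: frame_def loaded_def)
next
  case (3 j m)
  then have f: "frame {''u'', ''v''} {''acc'', ''G''} m0 m" by simp
  note fr = frame_nats[OF f] frame_reals[OF f]
  have tab: "reals m ''G'' [d', q', u, t'] =
       (if d' = d \<and> q' = Suc q \<and> t' = Suc t \<and> u < j
        then arm_value I bd i H (Suc t) u else reals m0 ''G'' [d', q', u, t'])" for d' q' u t'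
    using 3 by blast
  show ?case
  proof (rule runs_weaken[OF runs_cell_prog[where bd = bd and H = H and u = j and q = q and t = t and i = i]])
    show "loaded I m" by (rule loaded_frame[OF m f]) auto
    fix m' assume m': "frame {''v''} {''acc'', ''G''} m m' \<and>
      reals m' ''G'' = (reals m ''G'')([d, Suc q, j, Suc t] := arm_value I bd i H (Suc t) j)"
    then have "frame {''u'', ''v''} {''acc'', ''G''} m0 m'"
      by (intro frame_trans[OF f]) auto
    moreover have "nats m' ''u'' [] = j"
      using m' 3 by (auto simp: frame_def)
    ultimately show "nats m' ''u'' [] = j \<and> nats (set_nat ''u'' [] (Suc j) m') ''u'' [] = Suc j \<and>
      frame {''u'', ''v''} {''acc'', ''G''} m0 (set_nat ''u'' [] (Suc j) m') \<and>
      (\<forall>d' q' u t'. reals (set_nat ''u'' [] (Suc j) m') ''G'' [d', q', u, t'] =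
       (if d' = d \<and> q' = Suc q \<and> t' = Suc t \<and> u < Suc j
        then arm_value I bd i H (Suc t) u else reals m0 ''G'' [d', q', u, t']))"
      using m' tab by (simp add: frame_set_nat less_Suc_eq)
  qed (use 3 i q t bd H G tab fr in auto)
next
  case (4 m)
  then show ?case by simp
next
  case 5
  then show ?case using i by simp
qed

text \<open>The entries at time 0 are not computed; \<open>H0\<close> asks that they be right
  beforehand.\<close>

lemma runs_table_column:
  assumes m: "loaded I m0" and i: "nats m0 ''a'' [] = i" "i < arms I"
    and S: "num_states I i \<le> S" "horizon I \<le> S"
    and q: "nats m0 ''q'' [] = q"
    and bd: "bd = (\<lambda>i u. reals m0 ''bud'' [i, u])"
    and H: "\<And>t. t \<le> horizon I \<Longrightarrow> reals m0 ''G'' [d, q, 0, t] = H t"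
    and H0: "\<And>u. reals m0 ''G'' [d, Suc q, u, 0] = H 0"
  shows "runs (For ''t'' (nvar ''horizon'') (row_prog d)) m0 ((S + 1) * ((S + 1) * (cell_cost S + 2) + 2))
    (\<lambda>m. frame {''t'', ''u'', ''v''} {''acc'', ''G''} m0 m \<and>
      (\<forall>d' q' u t. d' \<noteq> d \<or> q' \<noteq> Suc q \<longrightarrow> reals m ''G'' [d', q', u, t] = reals m0 ''G'' [d', q', u, t]) \<and>
      (\<forall>u<num_states I i. \<forall>t\<le>horizon I. reals m ''G'' [d, Suc q, u, t] = arm_value I bd i H t u))"
proof (rule runs_For[where n = "horizon I" and Inv = "\<lambda>j m. nats m ''t'' [] = j \<and>
    frame {''t'', ''u'', ''v''} {''acc'', ''G''} m0 m \<and>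
      (\<forall>d' q' u t. d' \<noteq> d \<or> q' \<noteq> Suc q \<longrightarrow> reals m ''G'' [d', q', u, t] = reals m0 ''G'' [d', q', u, t]) \<and>
      (\<forall>u<num_states I i. \<forall>t\<le>j. reals m ''G'' [d, Suc q, u, t] = arm_value I bd i H t u)"], goal_cases)
  case 1
  then show ?case using H0 by (simp add: frame_set_nat frame_refl)
next
  case (2 j m)
  then show ?case using m by (simp add: frame_def loaded_def)
next
  case (3 j m)
  then have f: "frame {''t'', ''u'', ''v''} {''acc'', ''G''} m0 m" by simp
  note fr = frame_nats[OF f] frame_reals[OF f]
  have same: "reals m ''G'' [d', q', u, t] = reals m0 ''G'' [d', q', u, t]" if "d' \<noteq> d \<or> q' \<noteq> Suc q" for d' q' u t
    using 3 that by blast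
  have tab: "reals m ''G'' [d, Suc q, u, t] = arm_value I bd i H t u" if "u < num_states I i" "t \<le> j" for u t
    using 3 that by blast
  show ?case
  proof (rule runs_weaken[OF runs_row_prog[where bd = bd and H = H and q = q and t = j and i = i]])
    show "loaded I m" by (rule loaded_frame[OF m f]) auto
    fix m' assume m': "frame {''u'', ''v''} {''acc'', ''G''} m m' \<and>
      (\<forall>d' q' u t'. reals m' ''G'' [d', q', u, t'] =
       (if d' = d \<and> q' = Suc q \<and> t' = Suc j \<and> u < num_states I i
        then arm_value I bd i H (Suc j) u else reals m ''G'' [d', q', u, t']))"
    then have "frame {''t'', ''u'', ''v''} {''acc'', ''G''} m0 m'"
      by (intro frame_trans[OF f]) auto
    moreover have "nats m' ''t'' [] = j"
      using m' 3 by (auto simp: frame_def)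
    moreover have "reals m' ''G'' [d', q', u, t'] =
       (if d' = d \<and> q' = Suc q \<and> t' = Suc j \<and> u < num_states I i
        then arm_value I bd i H (Suc j) u else reals m ''G'' [d', q', u, t'])" for d' q' u t'
      using m' by blast
    ultimately show "nats m' ''t'' [] = j \<and> nats (set_nat ''t'' [] (Suc j) m') ''t'' [] = Suc j \<and>
      frame {''t'', ''u'', ''v''} {''acc'', ''G''} m0 (set_nat ''t'' [] (Suc j) m') \<and>
      (\<forall>d' q' u t. d' \<noteq> d \<or> q' \<noteq> Suc q \<longrightarrow>
         reals (set_nat ''t'' [] (Suc j) m') ''G'' [d', q', u, t] = reals m0 ''G'' [d', q', u, t]) \<and>
      (\<forall>u<num_states I i. \<forall>t\<le>Suc j.
         reals (set_nat ''t'' [] (Suc j) m') ''G'' [d, Suc q, u, t] = arm_value I bd i H t u)"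
      using same tab by (auto simp del: arm_value.simps simp: frame_set_nat le_Suc_eq)
  qed (use 3 i q S bd H fr same tab in auto)
next
  case (4 m)
  then show ?case by simp
next
  case 5
  then show ?case using S by simp
qed

lemma order_exp_eval:
  "nats m ''arms'' [] = arms I \<Longrightarrow> neval m (order_exp d) = arm_order I d (nats m ''q'' [])"
  by (simp add: order_exp_def arm_order_def)

lemma arm_order_less: "q < arms I \<Longrightarrow> arm_order I d q < arms I"
  by (auto simp: arm_order_def)

definition table_ok :: "bandit \<Rightarrow> (nat \<Rightarrow> nat \<Rightarrow> real) \<Rightarrow> nat \<Rightarrow> nat \<Rightarrow> mem \<Rightarrow> bool" where
  "table_ok I bd d k m \<longleftrightarrow> (\<forall>u t. reals m ''G'' [d, 0, u, t] = 0) \<and>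
     (\<forall>q<k. \<forall>u<num_states I (arm_order I d q). \<forall>t\<le>horizon I. reals m ''G'' [d, Suc q, u, t] =
        arm_value I bd (arm_order I d q) (stage_value I bd (arm_order I d) q) t u)"

lemma table_ok_stage:
  assumes "table_ok I bd d k m" "q \<le> k" "k \<le> arms I" "t \<le> horizon I"
    and "\<And>i. i < arms I \<Longrightarrow> 0 < num_states I i"
  shows "reals m ''G'' [d, q, 0, t] = stage_value I bd (arm_order I d) q t"
proof (cases q)
  case (Suc q')
  then have "0 < num_states I (arm_order I d q')" using assms arm_order_less[of q' I d] by simp
  then show ?thesis using assms Suc by (simp add: table_ok_def)
qed (use assms in \<open>simp add: table_ok_def\<close>)

lemma runs_table_prog:
  assumes m: "loaded I m0"
    and S: "arms I \<le> S" "horizon I \<le> S" "\<And>i. i < arms I \<Longrightarrow> num_states I i \<le> S"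
    and pos: "\<And>i. i < arms I \<Longrightarrow> 0 < num_states I i"
    and bd: "bd = (\<lambda>i u. reals m0 ''bud'' [i, u])"
    and G0: "\<And>q u t. reals m0 ''G'' [d, q, u, t] = 0"
  shows "runs (table_prog d) m0 (table_cost S)
    (\<lambda>m. frame {''q'', ''a'', ''t'', ''u'', ''v''} {''acc'', ''G''} m0 m \<and>
      (\<forall>d' q u t. d' \<noteq> d \<longrightarrow> reals m ''G'' [d', q, u, t] = reals m0 ''G'' [d', q, u, t]) \<and>
      table_ok I bd d (arms I) m)"
  unfolding table_prog_def table_cost_def
proof (rule runs_For[where n = "arms I" and Inv = "\<lambda>j m. nats m ''q'' [] = j \<and>
    frame {''q'', ''a'', ''t'', ''u'', ''v''} {''acc'', ''G''} m0 m \<and>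
      (\<forall>d' q u t. d' \<noteq> d \<longrightarrow> reals m ''G'' [d', q, u, t] = reals m0 ''G'' [d', q, u, t]) \<and>
      (\<forall>q>j. \<forall>u t. reals m ''G'' [d, q, u, t] = 0) \<and> table_ok I bd d j m"], goal_cases)
  case 1
  then show ?case using G0 by (simp add: frame_set_nat frame_refl table_ok_def)
next
  case (2 j m)
  then show ?case using m by (simp add: frame_def loaded_def)
next
  case (3 j m)
  define i where "i = arm_order I d j"
  have i: "i < arms I" using arm_order_less 3 by (simp add: i_def)
  have f: "frame {''q'', ''a'', ''t'', ''u'', ''v''} {''acc'', ''G''} m0 m" using 3 by simp
  have load: "loaded I m" by (rule loaded_frame[OF m f]) auto
  define m1 where "m1 = set_nat ''a'' [] i m"
  have f1: "frame {''q'', ''a'', ''t'', ''u'', ''v''} {''acc'', ''G''} m0 m1"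
    using f by (simp add: m1_def frame_set_nat)
  have set: "runs (NSet ''a'' [] (order_exp d)) m 1 (\<lambda>m'. m' = m1)"
    using load 3 by (intro runs_NSet) (simp add: order_exp_eval[of m I] loaded_def m1_def i_def)
  have same: "reals m ''G'' [d', q, u, t] = reals m0 ''G'' [d', q, u, t]" if "d' \<noteq> d" for d' q u t
    using 3 that by blast
  have zero: "reals m ''G'' [d, q, u, t] = 0" if "j < q" for q u t
    using 3 that by blast
  have tab: "table_ok I bd d j m" using 3 by blast
  show ?case
  proof (rule runs_Seq[OF set], rule runs_weaken[OF runs_table_column[where bd = bd and q = j and i = i
        and H = "stage_value I bd (arm_order I d) j"]], simp_all only:)
    show "loaded I m1" by (rule loaded_frame[OF m f1]) auto
    show "reals m1 ''G'' [d, j, 0, t] = stage_value I bd (arm_order I d) j t" if "t \<le> horizon I" for t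
      using table_ok_stage[OF tab order.refl] 3 that pos by (simp add: m1_def)
    \<comment> \<open>Stages beyond \<open>j\<close> are still untouched, and their initial 0 is the
      value with no time left.\<close>
    show "reals m1 ''G'' [d, Suc j, u, 0] = stage_value I bd (arm_order I d) j 0" for u
      using zero by (simp add: m1_def stage_value_time_0)
    fix m' assume m': "frame {''t'', ''u'', ''v''} {''acc'', ''G''} m1 m' \<and>
      (\<forall>d' q' u t. d' \<noteq> d \<or> q' \<noteq> Suc j \<longrightarrow> reals m' ''G'' [d', q', u, t] = reals m1 ''G'' [d', q', u, t]) \<and>
      (\<forall>u<num_states I i. \<forall>t\<le>horizon I. reals m' ''G'' [d, Suc j, u, t] =
         arm_value I bd i (stage_value I bd (arm_order I d) j) t u)"
    then have fr: "frame {''q'', ''a'', ''t'', ''u'', ''v''} {''acc'', ''G''} m0 m'"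
      by (intro frame_trans[OF f1]) auto
    have q: "nats m' ''q'' [] = j"
      using m' 3 by (auto simp: frame_def m1_def)
    have same': "reals m' ''G'' [d', q', u, t] = reals m ''G'' [d', q', u, t]" if "d' \<noteq> d \<or> q' \<noteq> Suc j" for d' q' u t
      using m' that by (simp add: m1_def)
    have "table_ok I bd d (Suc j) m'"
      using tab same' m' by (auto simp: table_ok_def less_Suc_eq i_def)
    then show "nats m' ''q'' [] = j \<and> nats (set_nat ''q'' [] (Suc j) m') ''q'' [] = Suc j \<and>
      frame {''q'', ''a'', ''t'', ''u'', ''v''} {''acc'', ''G''} m0 (set_nat ''q'' [] (Suc j) m') \<and>
      (\<forall>d' q u t. d' \<noteq> d \<longrightarrow> reals (set_nat ''q'' [] (Suc j) m') ''G'' [d', q, u, t] = reals m0 ''G'' [d', q, u, t]) \<and>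
      (\<forall>q>Suc j. \<forall>u t. reals (set_nat ''q'' [] (Suc j) m') ''G'' [d, q, u, t] = 0) \<and>
      table_ok I bd d (Suc j) (set_nat ''q'' [] (Suc j) m')"
      using fr q same same' zero by (simp add: frame_set_nat table_ok_def)
  qed (use i S 3 bd frame_reals[OF f] in \<open>auto simp: m1_def\<close>)
next
  case (4 m)
  then show ?case by simp
next
  case 5
  then show ?case using S by simp
qed


section \<open>Choosing the arm\<close>

text \<open>The recursion of \<open>pick_arm\<close> run upwards: each later success overwrites
  \<open>arm\<close>, until the flag \<open>f\<close> records an arm away from its root. The flag is
  set after the comparison, because the arm in progress itself remains eligible. Setting
  \<open>q\<close> to 0 first makes \<open>order_exp d\<close> denote the default
  \<open>ord 0\<close>.\<close>

definition pick_prog :: "nat \<Rightarrow> com" where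
  "pick_prog d = Seq (NSet ''f'' [] (NConst 0)) (Seq (NSet ''q'' [] (NConst 0)) (Seq (NSet ''arm'' [] (order_exp d))
     (For ''q'' (nvar ''arms'') (Seq (NSet ''a'' [] (order_exp d)) (Cond (NLess (nvar ''f'') (NConst 1))
       (Seq (Cond (RLess (RGet ''G'' [NConst d, nvar ''q'', NConst 0, nvar ''time''])
                (RGet ''G'' [NConst d, NAdd (nvar ''q'') (NConst 1), NGet ''current'' [nvar ''a''], nvar ''time'']))
              (NSet ''arm'' [] (nvar ''a'')) Skip)
            (Cond (NLess (NConst 0) (NGet ''current'' [nvar ''a''])) (NSet ''f'' [] (NConst 1)) Skip))
       Skip)))))"

definition pick_cost :: "nat \<Rightarrow> nat" where
  "pick_cost S = 1 + (1 + (1 + (S + 1) * (1 + (2 + 2 + 1) + 2)))"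

lemma runs_pick_prog:
  assumes m: "nats m0 ''arms'' [] = arms I" "nats m0 ''time'' [] = t"
      "\<And>i. i < arms I \<Longrightarrow> nats m0 ''current'' [i] = s i"
    and tab: "table_ok I bd d (arms I) m0" and t: "t \<le> horizon I"
    and s: "\<And>i. i < arms I \<Longrightarrow> s i < num_states I i" and S: "arms I \<le> S"
  shows "runs (pick_prog d) m0 (pick_cost S)
    (\<lambda>m. nats m ''arm'' [] = pick_arm I bd (arm_order I d) t s (arms I))"
proof -
  let ?ord = "arm_order I d"
  have stage: "reals m0 ''G'' [d, q, 0, t] = stage_value I bd ?ord q t" if "q \<le> arms I" for q
    using table_ok_stage[OF tab that order.refl t] s by fastforce
  have cell: "reals m0 ''G'' [d, Suc q, s (?ord q), t] = arm_value I bd (?ord q) (stage_value I bd ?ord q) t (s (?ord q))"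
    if "q < arms I" for q
    using tab that t s[OF arm_order_less[OF that]] by (simp add: table_ok_def)
  define J where "J k m \<longleftrightarrow> frame {''f'', ''q'', ''arm'', ''a''} {} m0 m \<and>
    nats m ''arm'' [] = pick_arm I bd ?ord t s k \<and> (nats m ''f'' [] = 0 \<longleftrightarrow> (\<forall>j<k. s (?ord j) = 0))" for k m
  have loop: "runs (For ''q'' (nvar ''arms'') (Seq (NSet ''a'' [] (order_exp d)) (Cond (NLess (nvar ''f'') (NConst 1))
       (Seq (Cond (RLess (RGet ''G'' [NConst d, nvar ''q'', NConst 0, nvar ''time''])
                (RGet ''G'' [NConst d, NAdd (nvar ''q'') (NConst 1), NGet ''current'' [nvar ''a''], nvar ''time'']))
              (NSet ''arm'' [] (nvar ''a'')) Skip)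
            (Cond (NLess (NConst 0) (NGet ''current'' [nvar ''a''])) (NSet ''f'' [] (NConst 1)) Skip))
       Skip))) m ((S + 1) * (1 + (2 + 2 + 1) + 2)) (J (arms I))" if "J 0 m" for m
  proof (rule runs_For[where n = "arms I" and Inv = "\<lambda>k m. nats m ''q'' [] = k \<and> J k m"], goal_cases)
    case 1
    then show ?case using that by (auto simp: J_def intro: frame_set_nat)
  next
    case (2 k m)
    then have "frame {''f'', ''q'', ''arm'', ''a''} {} m0 m" by (simp add: J_def)
    then show ?case using 2 m by (simp add: frame_nats)
  next
    case (3 k m)
    define i where "i = ?ord k"
    have i: "i < arms I" using arm_order_less 3 by (simp add: i_def)
    have f: "frame {''f'', ''q'', ''arm'', ''a''} {} m0 m" using 3 by (simp add: J_def)
    define m1 where "m1 = set_nat ''a'' [] i m"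
    have f1: "frame {''f'', ''q'', ''arm'', ''a''} {} m0 m1" using f by (simp add: m1_def frame_set_nat)
    have set: "runs (NSet ''a'' [] (order_exp d)) m 1 (\<lambda>m'. m' = m1)"
      using m 3 frame_nats[OF f] by (intro runs_NSet) (simp add: order_exp_eval[of m I] m1_def i_def)
    have fr: "nats m' ''time'' [] = t" "nats m' ''current'' [i] = s i" "reals m' = reals m0"
      if "frame {''f'', ''q'', ''arm'', ''a''} {} m0 m'" for m'
      using frame_nats[OF that] frame_reals[OF that] m i by auto
    let ?better = "stage_value I bd ?ord k t < arm_value I bd i (stage_value I bd ?ord k) t (s i)"
    define m2 where "m2 = (if ?better then set_nat ''arm'' [] i m1 else m1)"
    have f2: "frame {''f'', ''q'', ''arm'', ''a''} {} m0 m2" using f1 by (simp add: m2_def frame_set_nat)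
    have q1: "nats m1 ''q'' [] = k" "nats m1 ''a'' [] = i" using 3 by (simp_all add: m1_def)
    have choose: "runs (Cond (RLess (RGet ''G'' [NConst d, nvar ''q'', NConst 0, nvar ''time''])
                (RGet ''G'' [NConst d, NAdd (nvar ''q'') (NConst 1), NGet ''current'' [nvar ''a''], nvar ''time'']))
              (NSet ''arm'' [] (nvar ''a'')) Skip) m1 (1 + 1) (\<lambda>m'. m' = m2)"
      using fr[OF f1] q1 stage[of k] cell[of k] 3
      by (intro runs_Cond runs_NSet runs_Skip) (auto simp: m2_def i_def)
    have a2: "nats m2 ''a'' [] = i" using q1 by (simp add: m2_def)
    have flag: "runs (Cond (NLess (NConst 0) (NGet ''current'' [nvar ''a''])) (NSet ''f'' [] (NConst 1)) Skip) m2 (1 + 1)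
       (\<lambda>m'. m' = (if s i = 0 then m2 else set_nat ''f'' [] 1 m2))"
      using fr[OF f2] a2 by (intro runs_Cond runs_NSet runs_Skip) auto
    have "runs (Cond (NLess (nvar ''f'') (NConst 1))
       (Seq (Cond (RLess (RGet ''G'' [NConst d, nvar ''q'', NConst 0, nvar ''time''])
                (RGet ''G'' [NConst d, NAdd (nvar ''q'') (NConst 1), NGet ''current'' [nvar ''a''], nvar ''time'']))
              (NSet ''arm'' [] (nvar ''a'')) Skip)
            (Cond (NLess (NConst 0) (NGet ''current'' [nvar ''a''])) (NSet ''f'' [] (NConst 1)) Skip))
       Skip) m1 (1 + 1 + (1 + 1) + 1)
       (\<lambda>m'. m' = (if nats m ''f'' [] = 0 then if s i = 0 then m2 else set_nat ''f'' [] 1 m2 else m1))"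
    proof (rule runs_Cond, goal_cases)
      case 1
      then have "nats m ''f'' [] = 0" by (simp add: m1_def)
      then show ?case using runs_Seq[OF choose] flag by simp
    next
      case 2
      then have "nats m ''f'' [] \<noteq> 0" by (simp add: m1_def)
      then show ?case by (intro runs_Skip) auto
    qed
    then have body: "runs (Cond (NLess (nvar ''f'') (NConst 1))
       (Seq (Cond (RLess (RGet ''G'' [NConst d, nvar ''q'', NConst 0, nvar ''time''])
                (RGet ''G'' [NConst d, NAdd (nvar ''q'') (NConst 1), NGet ''current'' [nvar ''a''], nvar ''time'']))
              (NSet ''arm'' [] (nvar ''a'')) Skip)
            (Cond (NLess (NConst 0) (NGet ''current'' [nvar ''a''])) (NSet ''f'' [] (NConst 1)) Skip))
       Skip) m1 (2 + 2 + 1)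
       (\<lambda>m'. nats m' ''q'' [] = k \<and> nats (set_nat ''q'' [] (Suc k) m') ''q'' [] = Suc k \<and>
          J (Suc k) (set_nat ''q'' [] (Suc k) m'))"
    proof (rule runs_weaken)
      fix m' assume m': "m' = (if nats m ''f'' [] = 0 then if s i = 0 then m2 else set_nat ''f'' [] 1 m2 else m1)"
      have frame': "frame {''f'', ''q'', ''arm'', ''a''} {} m0 m'"
        using f1 f2 by (simp add: m' frame_set_nat)
      have q': "nats m' ''q'' [] = k"
        using q1 by (simp add: m' m2_def)
      have arm: "nats m ''arm'' [] = pick_arm I bd ?ord t s k" "nats m ''f'' [] = 0 \<longleftrightarrow> (\<forall>j<k. s (?ord j) = 0)"
        using 3 by (simp_all add: J_def)
      have arm': "nats m' ''arm'' [] = pick_arm I bd ?ord t s (Suc k)"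
        using arm by (auto simp: m' m2_def m1_def i_def)
      have flag': "nats m' ''f'' [] = 0 \<longleftrightarrow> (\<forall>j<Suc k. s (?ord j) = 0)"
        using arm(2) by (auto simp: m' m2_def m1_def i_def less_Suc_eq)
      show "nats m' ''q'' [] = k \<and> nats (set_nat ''q'' [] (Suc k) m') ''q'' [] = Suc k \<and>
          J (Suc k) (set_nat ''q'' [] (Suc k) m')"
        using frame' q' arm' flag' by (simp add: J_def frame_set_nat del: pick_arm.simps)
    qed simp
    show ?case by (rule runs_Seq[OF set]) (use body in simp)
  next
    case (4 m)
    then show ?case by simp
  next
    case 5
    then show ?case using S by simp
  qed
  have init: "J 0 (set_nat ''arm'' [] (?ord 0) (set_nat ''q'' [] 0 (set_nat ''f'' [] 0 m0)))"
    by (simp add: J_def frame_set_nat frame_refl)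
  have "runs (pick_prog d) m0 (pick_cost S) (J (arms I))"
    unfolding pick_prog_def pick_cost_def
    apply (rule runs_Seq[OF runs_NSet[where Q = "\<lambda>m. m = set_nat ''f'' [] 0 m0"]], simp)
    apply (rule runs_Seq[OF runs_NSet[where Q = "\<lambda>m. m = set_nat ''q'' [] 0 (set_nat ''f'' [] 0 m0)"]], simp)
    apply (rule runs_Seq[OF runs_NSet[where Q = "J 0"] loop])
    using init m(1) by (auto simp: order_exp_eval[of _ I])
  then show ?thesis by (rule runs_weaken) (auto simp: J_def)
qed

section \<open>The approximation algorithm\<close>

definition plan_prog :: com where
  "plan_prog = Seq budget_prog (Seq (table_prog 0) (table_prog 1))"

text \<open>The orders are compared at the full horizon rather than at the current time, so every
  query selects the same one and the answers form a single sequential policy.\<close>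

definition act_prog :: com where
  "act_prog = Cond (RLess (RGet ''G'' [NConst 0, nvar ''arms'', NConst 0, nvar ''horizon''])
       (RGet ''G'' [NConst 1, nvar ''arms'', NConst 0, nvar ''horizon'']))
     (pick_prog 1) (pick_prog 0)"

text \<open>\<open>x\<close> stands for \<open>S + 1\<close>, the factor that each loop
  contributes.\<close>

definition cost_poly :: "nat poly" where
  "cost_poly = (let x = [:1, 1:] in
     x * 3 + x * (x * (x * (x * 5 + 2) + 2) + 2) +
     2 * (x * (1 + x * (x * (1 + (x * 4 + 2) + 2) + 2) + 2)) + (3 + x * 8 + 1))"

lemma poly_cost_poly:
  "poly cost_poly S = budget_cost S + (table_cost S + table_cost S) + (pick_cost S + 1)"
  by (simp add: cost_poly_def budget_cost_def table_cost_def cell_cost_def pick_cost_def Let_def algebra_simps)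

lemma posterior_space_parent:
  assumes "posterior_space M T N P X" "v < N" "v \<noteq> 0"
  shows "\<exists>u<N. 0 < P u v"
proof -
  have "(0, v) \<in> {(a, b). a < N \<and> b < N \<and> 0 < P a b}\<^sup>*"
    using assms by (simp add: posterior_space_def)
  then show ?thesis using assms(3) by (cases rule: rtrancl.cases) auto
qed

text \<open>The number of arms is not a summand of \<open>input_size\<close>, but every arm has at
  least one state.\<close>

lemma input_size_bounds:
  assumes "\<And>i. i < arms I \<Longrightarrow> 0 < num_states I i"
  shows "arms I \<le> input_size I" "horizon I \<le> input_size I" "i < arms I \<Longrightarrow> num_states I i \<le> input_size I"
proof -
  have "arms I = (\<Sum>i<arms I. 1)" by simp
  also have "\<dots> \<le> (\<Sum>i<arms I. num_states I i)" using assms by (intro sum_mono) (auto simp: Suc_leI)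
  finally show "arms I \<le> input_size I" by (simp add: input_size_def)
  show "num_states I i \<le> input_size I" if "i < arms I"
    using member_le_sum[of i "{..<arms I}" "num_states I"] that by (simp add: input_size_def)
qed (simp add: input_size_def)

section \<open>Correctness of planning and acting\<close>

context graded_bandit
begin

text \<open>The witness \<open>bd'\<close> is the budget array as it stands in memory: the tables
  are correct for it at all states, while it is compared with \<open>bd\<close> only up to depth
  \<open>T\<close>.\<close>

lemma runs_plan_prog:
  assumes parent: "\<And>i v. \<lbrakk>i < n; v < N i; v \<noteq> 0\<rbrakk> \<Longrightarrow> \<exists>u<N i. 0 < P i u v"
  defines "S \<equiv> input_size I"
  shows "runs plan_prog (input_mem I) (budget_cost S + (table_cost S + table_cost S))
    (\<lambda>m. loaded I m \<and> (\<exists>bd'. (\<forall>i<n. \<forall>u<N i. dep i u \<le> T \<longrightarrow> bd' i u = bd i u) \<and>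
       (\<forall>d\<le>1. table_ok I bd' d n m)))"
proof -
  have load: "loaded I (input_mem I)" using prob_nonneg by (rule loaded_input_mem)
  have S: "n \<le> S" "T \<le> S" "\<And>i. i < n \<Longrightarrow> N i \<le> S"
    unfolding S_def using input_size_bounds states_pos by auto
  show ?thesis
    unfolding plan_prog_def
  proof (rule runs_Seq[OF runs_budget_prog[OF parent load S]])
    fix m1 assume m1: "budget_frame (input_mem I) m1 \<and>
      (\<forall>i<n. \<forall>u<N i. dep i u \<le> T \<longrightarrow> reals m1 ''bud'' [i, u] = bd i u)"
    define bd' where "bd' = (\<lambda>i u. reals m1 ''bud'' [i, u])"
    have load1: "loaded I m1" using m1 by (intro loaded_frame[OF load, of "{''k'', ''i'', ''u'', ''v''}" "{''bud''}"]) auto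
    have G1: "reals m1 ''G'' [d, q, u, t] = 0" for d q u t
      using m1 by (simp add: frame_def input_mem_def)
    show "runs (Seq (table_prog 0) (table_prog 1)) m1 (table_cost S + table_cost S)
      (\<lambda>m. loaded I m \<and> (\<exists>bd'. (\<forall>i<n. \<forall>u<N i. dep i u \<le> T \<longrightarrow> bd' i u = bd i u) \<and>
       (\<forall>d\<le>1. table_ok I bd' d n m)))"
    proof (rule runs_Seq[OF runs_table_prog[OF load1 S states_pos bd'_def G1]])
      fix m2 assume m2: "frame {''q'', ''a'', ''t'', ''u'', ''v''} {''acc'', ''G''} m1 m2 \<and>
        (\<forall>d' q u t. d' \<noteq> 0 \<longrightarrow> reals m2 ''G'' [d', q, u, t] = reals m1 ''G'' [d', q, u, t]) \<and>
        table_ok I bd' 0 n m2"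
      have load2: "loaded I m2"
        using m2 by (intro loaded_frame[OF load1, of "{''q'', ''a'', ''t'', ''u'', ''v''}" "{''acc'', ''G''}"]) auto
      have bd2: "bd' = (\<lambda>i u. reals m2 ''bud'' [i, u])"
        using m2 by (simp add: frame_def bd'_def)
      have G2: "reals m2 ''G'' [1, q, u, t] = 0" for q u t
        using m2 G1 by simp
      show "runs (table_prog 1) m2 (table_cost S)
        (\<lambda>m. loaded I m \<and> (\<exists>bd'. (\<forall>i<n. \<forall>u<N i. dep i u \<le> T \<longrightarrow> bd' i u = bd i u) \<and>
         (\<forall>d\<le>1. table_ok I bd' d n m)))"
      proof (rule runs_weaken[OF runs_table_prog[OF load2 S states_pos bd2 G2] order.refl])
        fix m3 assume m3: "frame {''q'', ''a'', ''t'', ''u'', ''v''} {''acc'', ''G''} m2 m3 \<and>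
          (\<forall>d' q u t. d' \<noteq> 1 \<longrightarrow> reals m3 ''G'' [d', q, u, t] = reals m2 ''G'' [d', q, u, t]) \<and>
          table_ok I bd' 1 n m3"
        have "loaded I m3"
          using m3 by (intro loaded_frame[OF load2, of "{''q'', ''a'', ''t'', ''u'', ''v''}" "{''acc'', ''G''}"]) auto
        moreover have "table_ok I bd' 0 n m3"
          using m2 m3 by (simp add: table_ok_def)
        moreover have "\<forall>d\<le>1. d = 0 \<or> d = (1 :: nat)" by auto
        ultimately show "loaded I m3 \<and> (\<exists>bd'. (\<forall>i<n. \<forall>u<N i. dep i u \<le> T \<longrightarrow> bd' i u = bd i u) \<and>
            (\<forall>d\<le>1. table_ok I bd' d n m3))"
          using m1 m3 by (metis bd'_def)
      qed
    qed
  qed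
qed

lemma computes_better_order:
  assumes parent: "\<And>i v. \<lbrakk>i < n; v < N i; v \<noteq> 0\<rbrakk> \<Longrightarrow> \<exists>u<N i. 0 < P i u v"
  obtains bd' d where "graded_bandit I dep bd'"
    and "computes_policy_within plan_prog act_prog (poly cost_poly (input_size I)) I
      (sequential_policy I bd' (arm_order I d))"
    and "\<And>d'. d' \<le> 1 \<Longrightarrow> stage_value I bd' (arm_order I d') n T \<le> stage_value I bd' (arm_order I d) n T"
proof -
  let ?S = "input_size I"
  obtain k m bd' where k: "k \<le> budget_cost ?S + (table_cost ?S + table_cost ?S)"
    and exec: "exec plan_prog (input_mem I) k m" and load: "loaded I m"
    and bd': "\<And>i u. \<lbrakk>i < n; u < N i; dep i u \<le> T\<rbrakk> \<Longrightarrow> bd' i u = bd i u"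
    and tab: "\<And>d. d \<le> 1 \<Longrightarrow> table_ok I bd' d n m"
    using runs_plan_prog[OF parent] unfolding runs_def by blast
  let ?V = "\<lambda>d. stage_value I bd' (arm_order I d) n T"
  \<comment> \<open>This mirrors the test in \<open>act_prog\<close>, so the order chosen at run
    time is \<open>d\<close> at every query.\<close>
  define d :: nat where "d = (if ?V 0 < ?V 1 then 1 else 0)"
  have graded: "graded_bandit I dep bd'"
    by (rule graded_bandit_cong[OF graded_bandit_axioms bd'])
  have act: "\<exists>k' m'. k' \<le> poly cost_poly ?S \<and> exec act_prog (query_mem I t s b m) k' m' \<and>
      nats m' ''arm'' [] = sequential_policy I bd' (arm_order I d) t s b"
    if t: "t \<le> T" and s: "\<forall>i<n. s i < N i" for t s b
  proof -
    let ?m = "query_mem I t s b m"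
    have G: "reals ?m ''G'' = reals m ''G''" by (simp add: query_mem_def)
    have cnt: "nats ?m ''arms'' [] = n" "nats ?m ''horizon'' [] = T" "nats ?m ''time'' [] = t"
      "\<And>i. i < n \<Longrightarrow> nats ?m ''current'' [i] = s i"
      using load by (simp_all add: query_mem_def loaded_def)
    have tab': "table_ok I bd' d' n ?m" if "d' \<le> 1" for d'
      using tab[OF that] by (simp add: table_ok_def G)
    have V: "reals ?m ''G'' [d', n, 0, T] = ?V d'" if "d' \<le> 1" for d'
      using table_ok_stage[OF tab'[OF that]] states_pos by simp
    have pick: "runs (pick_prog d') ?m (pick_cost ?S)
        (\<lambda>m. nats m ''arm'' [] = pick_arm I bd' (arm_order I d') t s n)" if "d' \<le> 1" for d'
      using runs_pick_prog[OF cnt(1,3,4) tab'[OF that] t, of ?S] s input_size_bounds(1)[of I] states_pos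
      by simp
    have "runs act_prog ?m (pick_cost ?S + 1)
        (\<lambda>m. nats m ''arm'' [] = sequential_policy I bd' (arm_order I d) t s b)"
      unfolding act_prog_def
    proof (rule runs_Cond)
      assume "beval ?m (RLess (RGet ''G'' [NConst 0, nvar ''arms'', NConst 0, nvar ''horizon''])
         (RGet ''G'' [NConst 1, nvar ''arms'', NConst 0, nvar ''horizon'']))"
      then have "?V 0 < ?V 1" using V[of 0] V[of 1] by (simp add: cnt)
      then have "d = 1" by (simp add: d_def)
      then show "runs (pick_prog 1) ?m (pick_cost ?S)
          (\<lambda>m. nats m ''arm'' [] = sequential_policy I bd' (arm_order I d) t s b)"
        using pick[of 1] by (simp add: sequential_policy_def)
    next
      assume "\<not> beval ?m (RLess (RGet ''G'' [NConst 0, nvar ''arms'', NConst 0, nvar ''horizon''])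
         (RGet ''G'' [NConst 1, nvar ''arms'', NConst 0, nvar ''horizon'']))"
      then have "\<not> ?V 0 < ?V 1" using V[of 0] V[of 1] by (simp add: cnt)
      then have "d = 0" by (simp add: d_def)
      then show "runs (pick_prog 0) ?m (pick_cost ?S)
          (\<lambda>m. nats m ''arm'' [] = sequential_policy I bd' (arm_order I d) t s b)"
        using pick[of 0] by (simp add: sequential_policy_def)
    qed
    then show ?thesis
      unfolding runs_def poly_cost_poly by (meson le_add2 order_trans)
  qed
  have "computes_policy_within plan_prog act_prog (poly cost_poly ?S) I
      (sequential_policy I bd' (arm_order I d))"
    unfolding computes_policy_within_def
  proof (rule exI[of _ k], rule exI[of _ m], intro conjI allI impI)
    show "k \<le> poly cost_poly ?S" using k by (simp add: poly_cost_poly)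
    show "exec plan_prog (input_mem I) k m" by (rule exec)
  qed (use act in blast)
  moreover have "?V d' \<le> ?V d" if "d' \<le> 1" for d'
    using that by (cases "d' = 0") (auto simp: d_def le_Suc_eq)
  ultimately show ?thesis using that graded by blast
qed

end

theorem theorem2:
  "\<exists>(plan :: com) (act :: com) (q :: nat poly).
     \<forall>(I :: bandit) (prior :: nat \<Rightarrow> real measure measure). bayesian_bandit I prior \<longrightarrow>
       (\<exists>\<pi> \<in> policies I.
          computes_policy_within plan act (poly q (input_size I)) I \<pi> \<and>
          expected_reward I prior \<pi> \<ge> optimal_reward I prior / 2)"
proof (rule exI[of _ plan_prog], rule exI[of _ act_prog], rule exI[of _ cost_poly], intro allI impI)
  fix I :: bandit and prior :: "nat \<Rightarrow> real measure measure"
  assume B: "bayesian_bandit I prior"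
  then have n: "0 < arms I"
    and parent: "\<And>i v. \<lbrakk>i < arms I; v < num_states I i; v \<noteq> 0\<rbrakk> \<Longrightarrow> \<exists>u<num_states I i. 0 < trans_prob I i u v"
    using posterior_space_parent by (auto simp: bayesian_bandit_def)
  obtain dep bd where "graded_bandit I dep bd"
    and reward: "\<And>bd' \<pi>. graded_bandit I dep bd' \<Longrightarrow> \<pi> \<in> policies I \<Longrightarrow>
      expected_reward I prior \<pi> = play_total I (mean_gain I bd') \<pi> (horizon I) (\<lambda>_. 0) (budget I)"
    using bayesian_bandit_is_graded[OF B] by blast
  then obtain bd' d where "graded_bandit I dep bd'"
    and comp: "computes_policy_within plan_prog act_prog (poly cost_poly (input_size I)) I
      (sequential_policy I bd' (arm_order I d))"
    and best: "\<And>d'. d' \<le> 1 \<Longrightarrow> stage_value I bd' (arm_order I d') (arms I) (horizon I)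
      \<le> stage_value I bd' (arm_order I d) (arms I) (horizon I)"
    using graded_bandit.computes_better_order[OF _ parent] by blast
  then interpret graded_bandit I dep bd' by simp
  let ?\<pi> = "sequential_policy I bd' (arm_order I d)"
  have \<pi>: "?\<pi> \<in> policies I"
    using arm_order_less n by (rule sequential_policy_in_policies)
  have inj: "inj_on (arm_order I d) {..<arms I}"
    by (auto simp: inj_on_def arm_order_def)
  have attained: "stage_value I bd' (arm_order I d) (arms I) (horizon I) \<le> expected_reward I prior ?\<pi>"
    using sequential_policy_attains_stage_value[OF arm_order_less inj n] reward[OF graded_bandit_axioms \<pi>]
    by simp
  have "expected_reward I prior \<pi>' \<le> 2 * expected_reward I prior ?\<pi>" if "\<pi>' \<in> policies I" for \<pi>'
  proof -
    have "expected_reward I prior \<pi>' \<le> stage_value I bd' (arm_order I 0) (arms I) (horizon I) +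
        stage_value I bd' (arm_order I 1) (arms I) (horizon I)"
      using play_total_le_both_orders[OF that] reward[OF graded_bandit_axioms that]
      by (simp add: arm_order_def[abs_def])
    \<comment> \<open>Both stage values are at most that of order \<open>d\<close>; this is where
      the factor 2 arises.\<close>
    then show ?thesis using best[of 0] best[of 1] attained by simp
  qed
  then have "optimal_reward I prior \<le> 2 * expected_reward I prior ?\<pi>"
    unfolding optimal_reward_def using \<pi> by (intro cSUP_least) auto
  then show "\<exists>\<pi>\<in>policies I. computes_policy_within plan_prog act_prog (poly cost_poly (input_size I)) I \<pi> \<and>
      expected_reward I prior \<pi> \<ge> optimal_reward I prior / 2"
    using \<pi> comp by (intro bexI[of _ ?\<pi>]) auto
qed

end
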